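(* Let $d\ge 2$ be an integer and $M>0$. For $n\in\mathbb{N}_0$ and $0\le k\le n/2$, let $\{Y_\nu^{n-2k}:1\le\nu\le a_{n-2k}^d\}$ be an orthonormal basis of $\mathcal{H}_{n-2k}^d$, let $\beta_k=n-2k+\frac{d-2}{2}$, and for $1\le\nu\le a_{n-2k}^d$ define $$P_{k,\nu}^n(x)=P_k^{(0,\beta_k)}\big(2\|x\|^2-1\big)\,Y_\nu^{n-2k}(x),\qquad Q_{k,\nu}^n(x)=q_k^{\beta_k,M}\big(2\|x\|^2-1\big)\,Y_\nu^{n-2k}(x).$$ The polynomials $Q_{k,\nu}^n$, $0\le k\le n/2$, $1\le\nu\le a_{n-2k}^d$, constitute a mutually orthogonal basis of $\mathcal{V}_n^d\big(W_{1/2},\frac{d}{2M}\big)$. They satisfy the relations $$\left[M-\tfrac14\big(1-\|x\|^2\big)\Delta\right]P_{k,\nu}^n(x)=Q_{k,\nu}^n(x),$$ $$\left[M+\tfrac d2-\tfrac14\big(1-\|x\|^2\big)\Delta+\langle x,\nabla\rangle\right]Q_{k,\nu}^n(x)=\Lambda_{n,k}P_{k,\nu}^n(x),$$ and the fourth-order partial differential equation $$\left[M-\tfrac14\big(1-\|x\|^2\big)\Delta\right]\left[M+\tfrac d2-\tfrac14\big(1-\|x\|^2\big)\Delta+\langle x,\nabla\rangle\right]Q_{k,\nu}^n(x)=\Lambda_{n,k}Q_{k,\nu}^n(x),$$ where $$\Lambda_{n,k}=\left(M+k\Big(n-k+\frac{d-2}{2}\Big)\right)\left(M+(k+1)\Big(n-k+\frac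 d2\Big)\right).$$
   Context: $\Delta=\sum_{i=1}^d\frac{\partial^2}{\partial x_i^2}$ is the Laplacian on $\mathbb{R}^d$, $\langle x,\nabla\rangle=\sum_{i=1}^d x_i\frac{\partial}{\partial x_i}$, and $\|\cdot\|$ is the Euclidean norm. $P_k^{(\alpha,\beta)}(t)$ denotes the classical Jacobi polynomial of degree $k$, orthogonal on $[-1,1]$ with respect to the weight $(1-t)^\alpha(1+t)^\beta$, normalized by $P_k^{(\alpha,\beta)}(1)=\binom{k+\alpha}{k}$. The Jacobi-type polynomials are, for $\beta>-1$, $M>0$ and $k=0,1,\ldots$, $$q_k^{\beta,M}(t)=\left[M-(1+t)\frac{d}{dt}+k(k+\beta+1)\right]P_k^{(0,\beta)}(t).$$ $\mathcal{H}_m^d$ is the space of real homogeneous polynomials $Y$ of degree $m$ in $d$ variables with $\Delta Y=0$, and $a_m^d=\dim\mathcal{H}_m^d$. Orthonormality in $\mathcal{H}_m^d$ is with respect to $\frac{1}{\sigma_{d-1}}\int_{\mathbb{S}^{d-1}}f(\xi)g(\xi)\,d\sigma(\xi)$, where $\mathbb{S}^{d-1}$ is the unit sphere, $d\sigma$ its surface measure and $\sigma_{d-1}=2\pi^{d/2}/\Gamma(d/2)$ its area. $W_{1/2}(x)=1$ on the closed unit ball $\mathbb{B}^d$, and $\omega_{1/2}=\int_{\mathbb{B}^d}dx$. For $\lambda>0$, $\mathcal{V}_n^d(W_{1/2},\lambda)$ is the space of all real polynomials $P$ in $d$ variables of total degree at most $n$ that are orthogonal to every polynomial of total degree at most $n-1$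 with respect to $$\langle f,g\rangle_{1/2}^\lambda=\frac{1}{\omega_{1/2}}\int_{\mathbb{B}^d}f(x)g(x)\,dx+\frac{\lambda}{\sigma_{d-1}}\int_{\mathbb{S}^{d-1}}f(\xi)g(\xi)\,d\sigma(\xi);$$ here $\lambda=\frac{d}{2M}$. A basis is mutually orthogonal if any two distinct elements of it are orthogonal with respect to this inner product. *)

theory Defs
  imports
    "HOL-Analysis.Analysis"
    "HOL-Computational_Algebra.Polynomial"
    "HOL-Library.Function_Algebras"
begin

text \<open>With this instance, \<^const>\<open>span\<close>, \<^const>\<open>independent\<close> and \<^const>\<open>dim\<close> are available for
  spaces of functions; the additive structure is the pointwise one of \<^theory>\<open>HOL-Library.Function_Algebras\<close>.\<close>

instantiation "fun" :: (type, real_vector) real_vector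
begin

definition scaleR_fun :: "real \<Rightarrow> ('a \<Rightarrow> 'b) \<Rightarrow> 'a \<Rightarrow> 'b" where
  "scaleR_fun c f = (\<lambda>x. c *\<^sub>R f x)"

instance
  by standard (auto simp: scaleR_fun_def fun_eq_iff algebra_simps)

end

definition indexed_basis :: "'i set \<Rightarrow> ('i \<Rightarrow> 'v::real_vector) \<Rightarrow> 'v set \<Rightarrow> bool" where
  "indexed_basis I b V \<longleftrightarrow> inj_on b I \<and> independent (b ` I) \<and> span (b ` I) = V"

text \<open>Real polynomials in \<open>d\<close> variables are identified with the polynomial functions on
  \<open>real ^ 'd\<close> that they induce, where \<open>d = CARD('d)\<close>.\<close>

definition monomial_fun :: "('d::finite \<Rightarrow> nat) \<Rightarrow> real ^ 'd \<Rightarrow> real" where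
  "monomial_fun a x = (\<Prod>i\<in>UNIV. (x $ i) ^ a i)"

definition polys_le :: "nat \<Rightarrow> (real ^ 'd::finite \<Rightarrow> real) set" where
  "polys_le n = span (monomial_fun ` {a. (\<Sum>i\<in>UNIV. a i) \<le> n})"

definition homogeneous_polys :: "nat \<Rightarrow> (real ^ 'd::finite \<Rightarrow> real) set" where
  "homogeneous_polys m = span (monomial_fun ` {a. (\<Sum>i\<in>UNIV. a i) = m})"

definition partial :: "'d \<Rightarrow> (real ^ 'd::finite \<Rightarrow> real) \<Rightarrow> real ^ 'd \<Rightarrow> real" where
  "partial i f x = deriv (\<lambda>t::real. f (x + t *\<^sub>R axis i 1)) 0"

definition laplacian :: "(real ^ 'd::finite \<Rightarrow> real) \<Rightarrow> real ^ 'd \<Rightarrow> real" where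
  "laplacian f x = (\<Sum>i\<in>UNIV. partial i (partial i f) x)"

definition euler_op :: "(real ^ 'd::finite \<Rightarrow> real) \<Rightarrow> real ^ 'd \<Rightarrow> real" where
  "euler_op f x = (\<Sum>i\<in>UNIV. x $ i * partial i f x)"

text \<open>\<open>op_PQ\<close> takes \<open>ball_P\<close> to \<open>ball_Q\<close>; \<open>op_QP\<close> takes \<open>ball_Q\<close> back to a multiple of \<open>ball_P\<close>.\<close>

definition op_PQ :: "real \<Rightarrow> (real ^ 'd::finite \<Rightarrow> real) \<Rightarrow> real ^ 'd \<Rightarrow> real" where
  "op_PQ M f x = M * f x - 1/4 * (1 - (norm x)\<^sup>2) * laplacian f x"

definition op_QP :: "real \<Rightarrow> (real ^ 'd::finite \<Rightarrow> real) \<Rightarrow> real ^ 'd \<Rightarrow> real" where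
  "op_QP M f x = (M + real CARD('d) / 2) * f x
     - 1/4 * (1 - (norm x)\<^sup>2) * laplacian f x + euler_op f x"

text \<open>Surface measure in polar coordinates: a Borel set \<open>A\<close> of unit vectors gets \<open>d\<close> times the
  volume of the cone \<open>{r \<xi> | 0 < r < 1, \<xi> \<in> A}\<close>. It is a measure on the Borel sets of the whole
  space, concentrated on the sphere.\<close>

definition surface_measure :: "'a::euclidean_space measure" where
  "surface_measure =
     distr (density lborel (\<lambda>x. of_nat DIM('a) * indicator (ball 0 1) x)) borel (\<lambda>x. x /\<^sub>R norm x)"

definition sphere_area :: "nat \<Rightarrow> real" where
  "sphere_area d = 2 * pi powr (real d / 2) / Gamma (real d / 2)"

lemma emeasure_surface_measure:
  assumes "A \<in> sets borel" "A \<subseteq> sphere (0::'a::euclidean_space) 1"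
  shows "emeasure surface_measure A =
     of_nat DIM('a) * emeasure lborel {x. norm x < 1 \<and> x /\<^sub>R norm x \<in> A}"
proof -
  have m: "(\<lambda>x::'a. x /\<^sub>R norm x) \<in> borel_measurable borel" by measurable
  have s: "(\<lambda>x::'a. x /\<^sub>R norm x) -` A \<in> sets borel"
    using measurable_sets[OF m assms(1)] by simp
  have w: "(\<lambda>x::'a. of_nat DIM('a) * indicator (ball 0 1) x :: ennreal) \<in> borel_measurable lborel"
    by (intro borel_measurable_times_ennreal borel_measurable_const borel_measurable_indicator) simp
  have eq: "{x. norm x < 1 \<and> x /\<^sub>R norm x \<in> A} = ball 0 1 \<inter> (\<lambda>x::'a. x /\<^sub>R norm x) -` A"
    by auto
  have "emeasure surface_measure A =
      (\<integral>\<^sup>+x. of_nat DIM('a) * indicator (ball 0 1) x * indicator ((\<lambda>x::'a. x /\<^sub>R norm x) -` A) x \<partial>lborel)"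
    unfolding surface_measure_def using assms m s w
    by (subst emeasure_distr, simp, simp, subst emeasure_density) auto
  also have "\<dots> = (\<integral>\<^sup>+x. of_nat DIM('a) * indicator (ball 0 1 \<inter> (\<lambda>x::'a. x /\<^sub>R norm x) -` A) x \<partial>lborel)"
    by (intro nn_integral_cong) (auto simp: indicator_def)
  also have "\<dots> = of_nat DIM('a) * emeasure lborel (ball 0 1 \<inter> (\<lambda>x::'a. x /\<^sub>R norm x) -` A)"
    using s by (subst nn_integral_cmult_indicator) auto
  finally show ?thesis by (simp add: eq)
qed

lemma emeasure_surface_measure_sphere:
  "emeasure surface_measure (sphere (0::'a::euclidean_space) 1) = ennreal (sphere_area DIM('a))"
proof -
  have d: "real DIM('a) > 0" by simp
  have "emeasure lborel {x::'a. norm x < 1 \<and> x /\<^sub>R norm x \<in> sphere 0 1} = emeasure lborel (ball (0::'a) 1 - {0})"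
    by (rule arg_cong[where f = "emeasure lborel"]) auto
  also have "\<dots> = emeasure lborel (ball (0::'a) 1)"
    by (rule emeasure_Diff_null_set) auto
  also have "\<dots> = ennreal (unit_ball_vol (real DIM('a)))"
    by (simp add: emeasure_ball)
  finally have "emeasure surface_measure (sphere (0::'a) 1)
      = of_nat DIM('a) * ennreal (unit_ball_vol (real DIM('a)))"
    by (subst emeasure_surface_measure) auto
  also have "\<dots> = ennreal (real DIM('a) * unit_ball_vol (real DIM('a)))"
    by (simp add: ennreal_mult ennreal_of_nat_eq_real_of_nat)
  also have "real DIM('a) * unit_ball_vol (real DIM('a)) = sphere_area DIM('a)"
  proof -
    have "Gamma (real DIM('a) / 2 + 1) = real DIM('a) / 2 * Gamma (real DIM('a) / 2)"
      using d by (intro Gamma_plus1) (metis half_gt_zero not_less nonpos_Ints_nonpos)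
    then show ?thesis
      unfolding unit_ball_vol_def sphere_area_def by (simp only:) simp
  qed
  finally show ?thesis .
qed

definition sphere_inner :: "(real ^ 'd::finite \<Rightarrow> real) \<Rightarrow> (real ^ 'd \<Rightarrow> real) \<Rightarrow> real" where
  "sphere_inner f g =
     1 / sphere_area CARD('d) * (LINT \<xi>:sphere 0 1|surface_measure. f \<xi> * g \<xi>)"

definition ball_sphere_inner ::
    "real \<Rightarrow> (real ^ 'd::finite \<Rightarrow> real) \<Rightarrow> (real ^ 'd \<Rightarrow> real) \<Rightarrow> real" where
  "ball_sphere_inner lam f g =
     1 / measure lborel (cball (0::real ^ 'd) 1) * (LINT x:cball 0 1|lborel. f x * g x)
     + lam / sphere_area CARD('d) * (LINT \<xi>:sphere 0 1|surface_measure. f \<xi> * g \<xi>)"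

definition orth_polys :: "nat \<Rightarrow> real \<Rightarrow> (real ^ 'd::finite \<Rightarrow> real) set" where
  "orth_polys n lam =
     {P \<in> polys_le n. \<forall>m<n. \<forall>R\<in>polys_le m. ball_sphere_inner lam P R = 0}"

definition harmonic_polys :: "nat \<Rightarrow> (real ^ 'd::finite \<Rightarrow> real) set" where
  "harmonic_polys m = {Y \<in> homogeneous_polys m. \<forall>x. laplacian Y x = 0}"

text \<open>The classical Jacobi polynomial, for \<open>\<alpha>, \<beta> > -1\<close>: the three conditions determine the polynomial uniquely.\<close>

definition jacobi :: "real \<Rightarrow> real \<Rightarrow> nat \<Rightarrow> real poly" where
  "jacobi \<alpha> \<beta> k = (THE p. degree p = k
     \<and> (\<forall>q. degree q < k \<longrightarrow>
          (LINT t:{-1..1}|lborel. poly p t * poly q t * ((1 - t) powr \<alpha> * (1 + t) powr \<beta>)) = 0)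
     \<and> poly p 1 = (real k + \<alpha>) gchoose k)"

definition jacobi_type :: "real \<Rightarrow> real \<Rightarrow> nat \<Rightarrow> real poly" where
  "jacobi_type \<beta> M k =
     smult M (jacobi 0 \<beta> k) - [:1, 1:] * pderiv (jacobi 0 \<beta> k)
     + smult (real k * (real k + \<beta> + 1)) (jacobi 0 \<beta> k)"

text \<open>\<open>Y m \<nu>\<close> is the \<open>\<nu>\<close>-th element, \<open>\<nu> \<ge> 1\<close>, of the
  chosen basis of the harmonic polynomials of degree \<open>m\<close>.\<close>

definition beta_par :: "nat \<Rightarrow> nat \<Rightarrow> nat \<Rightarrow> real" where
  "beta_par d n k = real n - 2 * real k + (real d - 2) / 2"

definition ball_P ::
    "(nat \<Rightarrow> nat \<Rightarrow> real ^ 'd::finite \<Rightarrow> real) \<Rightarrow> nat \<Rightarrow> nat \<Rightarrow> nat \<Rightarrow> real ^ 'd \<Rightarrow> real" where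
  "ball_P Y n k \<nu> x =
     poly (jacobi 0 (beta_par CARD('d) n k) k) (2 * (norm x)\<^sup>2 - 1) * Y (n - 2 * k) \<nu> x"

definition ball_Q ::
    "real \<Rightarrow> (nat \<Rightarrow> nat \<Rightarrow> real ^ 'd::finite \<Rightarrow> real) \<Rightarrow> nat \<Rightarrow> nat \<Rightarrow> nat \<Rightarrow> real ^ 'd \<Rightarrow> real" where
  "ball_Q M Y n k \<nu> x =
     poly (jacobi_type (beta_par CARD('d) n k) M k) (2 * (norm x)\<^sup>2 - 1) * Y (n - 2 * k) \<nu> x"

definition eigenval :: "nat \<Rightarrow> real \<Rightarrow> nat \<Rightarrow> nat \<Rightarrow> real" where
  "eigenval d M n k =
     (M + real k * (real n - real k + (real d - 2) / 2))
     * (M + (real k + 1) * (real n - real k + real d / 2))"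

end

theory Submission
  imports Defs
begin

text \<open>For \<open>f(x) = p(2|x|\<^sup>2 - 1) Y(x)\<close> with \<open>Y\<close> a solid harmonic, the operators act on the radial factor \<open>p\<close>
  alone, and the two first relations become identities that follow from the Jacobi differential equation
  and its derivative.

  The inner product of two such functions is a radial functional times the integral of the product of the harmonics
  over the sphere. Harmonics of different degree are orthogonal there, and for equal
  degree the boundary term with weight \<open>\<lambda> = d/(2M)\<close> cancels the boundary term which arises from
  \<open>(1 + t) d/dt\<close> by partial integration, because \<open>q\<^sub>k(1) = M\<close>.

  The leading homogeneous parts of the \<open>Q\<close>'s are nonzero multiples of \<open>|x|\<^sup>2\<^sup>k Y\<close>, and these span the homogeneous polynomials
  of degree \<open>n\<close>. Hence an element of the orthogonal space differs from
  a combination of the \<open>Q\<close>'s by an element of lower degree, which is orthogonal to itself.\<close>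

section \<open>Polynomial functions and the Laplacian\<close>

text \<open>\<open>surface_measure\<close> is given through volumes of cones, so the sphere is
  always reached from the ball. The bridge is homogeneity: for a polynomial homogeneous of degree h,
  its integral over the ball times d + h is its integral over the sphere. Applied to |x|^(2j) H for
  varying j, this plays the role of polar coordinates; applied to an integration by parts in the
  ball with a cutoff that vanishes at the boundary, it plays the role of the divergence theorem. In
  the variable t, a single integration by parts against \<open>(1 + t) powr \<beta>\<close> supplies
  all values, and ball and interval are compared on powers of 1 + t = 2|x|^2. Since
  \<open>jacobi\<close> is a definite description by orthogonality, it has to be identified with the
  polynomial solution of the Jacobi equation before any differential identity is available. The
  assumption d \<ge> 2 yields \<beta> \<ge> 0, which keeps the weight bounded.\<close>

text \<open>Indexing by a set of admissible total degrees lets one family of closure rules serve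
  \<open>polys_le\<close>, \<open>homogeneous_polys\<close>, all polynomials (\<open>UNIV\<close>)
  and degrees below \<open>n\<close> (\<open>{..<n}\<close>). The empty set gives the zero space, so
  membership in \<open>polys_of {}\<close> is a way to prove vanishing.\<close>

definition polys_of :: "nat set \<Rightarrow> (real ^ 'd::finite \<Rightarrow> real) set" where
  "polys_of A = span (monomial_fun ` {a. (\<Sum>i\<in>UNIV. a i) \<in> A})"

lemma polys_le_eq: "polys_le n = polys_of {..n}"
  by (simp add: polys_le_def polys_of_def)

lemma homogeneous_polys_eq: "homogeneous_polys m = polys_of {m}"
  by (simp add: homogeneous_polys_def polys_of_def)

lemma subspace_polys_of [simp]: "subspace (polys_of A)"
  by (simp add: polys_of_def)

lemma polys_of_mono: "A \<subseteq> B \<Longrightarrow> polys_of A \<subseteq> polys_of B"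
  unfolding polys_of_def by (intro span_mono image_mono) auto

lemma polys_of_zero [simp]: "(\<lambda>x. 0) \<in> polys_of A"
  using subspace_0[OF subspace_polys_of[of A]] by (simp add: zero_fun_def)

lemma polys_of_add: "f \<in> polys_of A \<Longrightarrow> g \<in> polys_of A \<Longrightarrow> (\<lambda>x. f x + g x) \<in> polys_of A"
  using subspace_add[OF subspace_polys_of[of A]] by (simp add: plus_fun_def)

lemma polys_of_cmult: "f \<in> polys_of A \<Longrightarrow> (\<lambda>x. c * f x) \<in> polys_of A"
  using subspace_scale[OF subspace_polys_of[of A]] by (simp add: scaleR_fun_def)

lemma polys_of_sum: "(\<And>i. i \<in> I \<Longrightarrow> f i \<in> polys_of A) \<Longrightarrow> (\<lambda>x. \<Sum>i\<in>I. f i x) \<in> polys_of A"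
  by (induction I rule: infinite_finite_induct) (auto intro: polys_of_add)

lemma polys_of_monomial: "(\<Sum>i\<in>UNIV. a i) \<in> A \<Longrightarrow> monomial_fun a \<in> polys_of A"
  unfolding polys_of_def by (intro span_base) auto

text \<open>Membership of the remainder \<open>g\<close> is carried through the induction, because
  linearity of \<open>partial\<close> is available only for functions known to be
  polynomial.\<close>

lemma polys_of_induct [consumes 1, case_names zero add]:
  assumes "f \<in> polys_of A" "P (\<lambda>x. 0)"
    and "\<And>c a g. (\<Sum>i\<in>UNIV. a i) \<in> A \<Longrightarrow> g \<in> polys_of A \<Longrightarrow> P g
          \<Longrightarrow> P (\<lambda>x. c * monomial_fun a x + g x)"
  shows "P f"
proof -
  have "f \<in> polys_of A \<and> P f"
    using assms(1) unfolding polys_of_def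
  proof (induction rule: span_induct_alt)
    case base
    show ?case using assms(2) by (simp add: zero_fun_def[symmetric] span_zero)
  next
    case (step c x y)
    then obtain a where a: "x = monomial_fun a" "(\<Sum>i\<in>UNIV. a i) \<in> A" by auto
    have eq: "c *\<^sub>R x + y = (\<lambda>z. c * monomial_fun a z + y z)"
      by (simp add: a scaleR_fun_def plus_fun_def)
    have y: "y \<in> polys_of A" "P y"
      using step.IH by (auto simp: polys_of_def)
    have "c *\<^sub>R x + y \<in> polys_of A"
      using y(1) a by (intro subspace_add subspace_scale) (auto intro: polys_of_monomial)
    moreover have "P (c *\<^sub>R x + y)"
      unfolding eq by (rule assms(3)[OF a(2) y])
    ultimately show ?case unfolding polys_of_def plus_fun_def by blast
  qed
  then show ?thesis by simp
qed

lemma monomial_fun_mult: "monomial_fun a x * monomial_fun b x = monomial_fun (\<lambda>i. a i + b i) x"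
  by (simp add: monomial_fun_def power_add prod.distrib)

lemma polys_of_mult:
  assumes "f \<in> polys_of A" "g \<in> polys_of B" and AB: "\<And>a b. a \<in> A \<Longrightarrow> b \<in> B \<Longrightarrow> a + b \<in> C"
  shows "(\<lambda>x. f x * g x) \<in> polys_of C"
  using assms(1)
proof (induction rule: polys_of_induct)
  case zero
  then show ?case by simp
next
  case (add c a h)
  have "(\<lambda>x. monomial_fun a x * g x) \<in> polys_of C"
    using assms(2)
  proof (induction rule: polys_of_induct)
    case zero
    then show ?case by simp
  next
    case (add e b h)
    have "(\<lambda>x. e * monomial_fun (\<lambda>i. a i + b i) x + monomial_fun a x * h x) \<in> polys_of C"
      using \<open>sum a UNIV \<in> A\<close> add
      by (intro polys_of_add polys_of_cmult polys_of_monomial) (auto simp: sum.distrib intro: AB)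
    then show ?case
      by (simp add: algebra_simps monomial_fun_mult[symmetric])
  qed
  then have "(\<lambda>x. c * (monomial_fun a x * g x) + h x * g x) \<in> polys_of C"
    using add by (intro polys_of_add polys_of_cmult)
  then show ?case by (simp add: algebra_simps)
qed

lemma polys_of_const: "0 \<in> A \<Longrightarrow> (\<lambda>x. c) \<in> polys_of A"
  using polys_of_cmult[OF polys_of_monomial[of "\<lambda>_. 0" A], of c] by (simp add: monomial_fun_def)

lemma monomial_fun_single: "monomial_fun (\<lambda>j. if j = i then m else 0) x = (x $ i) ^ m"
proof -
  have "(\<Prod>j\<in>UNIV. (x $ j) ^ (if j = i then m else 0)) = (\<Prod>j\<in>UNIV. if j = i then (x $ i) ^ m else 1)"
    by (intro prod.cong) auto
  then show ?thesis by (simp add: monomial_fun_def)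
qed

lemma polys_of_component: "1 \<in> A \<Longrightarrow> (\<lambda>x. x $ i) \<in> polys_of A"
  using polys_of_monomial[of "\<lambda>j. if j = i then 1 else 0" A]
  by (simp add: monomial_fun_single[of i 1, abs_def])

lemma norm_sq_vec: "(norm (x :: real ^ 'd::finite))\<^sup>2 = (\<Sum>i\<in>UNIV. x $ i * x $ i)"
  by (simp add: power2_norm_eq_inner inner_vec_def)

lemma polys_of_norm_sq_power:
  assumes "2 * k \<in> A"
  shows "(\<lambda>x :: real ^ 'd::finite. ((norm x)\<^sup>2) ^ k) \<in> polys_of A"
proof -
  have 2: "(\<lambda>x :: real ^ 'd::finite. (norm x)\<^sup>2) \<in> polys_of {2}"
    unfolding norm_sq_vec
    by (intro polys_of_sum polys_of_mult[where A = "{1}" and B = "{1}"] polys_of_component) auto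
  have "(\<lambda>x :: real ^ 'd::finite. ((norm x)\<^sup>2) ^ k) \<in> polys_of {2 * k}"
  proof (induction k)
    case 0
    then show ?case by (simp add: polys_of_const)
  next
    case (Suc k)
    then show ?case
      unfolding power_Suc by (intro polys_of_mult[OF 2]) auto
  qed
  then show ?thesis using polys_of_mono[of "{2 * k}" A] assms by auto
qed

lemma polys_of_radial: "(\<lambda>x :: real ^ 'd::finite. poly g ((norm x)\<^sup>2)) \<in> polys_of UNIV"
  unfolding poly_altdef by (intro polys_of_sum polys_of_cmult polys_of_norm_sq_power) auto

lemma polys_of_UNIV: "f \<in> polys_of A \<Longrightarrow> f \<in> polys_of UNIV"
  using polys_of_mono[of A UNIV] by auto

lemma polys_of_UNIV_mult: "f \<in> polys_of UNIV \<Longrightarrow> g \<in> polys_of UNIV \<Longrightarrow> (\<lambda>x. f x * g x) \<in> polys_of UNIV"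
  by (rule polys_of_mult) auto

lemma continuous_on_polys:
  assumes "f \<in> polys_of A"
  shows "continuous_on S f"
  using assms
  by (induction rule: polys_of_induct) (auto simp: monomial_fun_def intro!: continuous_intros)

lemma monomial_fun_scaleR: "monomial_fun a (c *\<^sub>R x) = c ^ (\<Sum>i\<in>UNIV. a i) * monomial_fun a x"
  by (simp add: monomial_fun_def power_mult_distrib prod.distrib power_sum)

lemma homogeneous_scaleR:
  assumes "f \<in> polys_of {m}"
  shows "f (c *\<^sub>R x) = c ^ m * f x"
  using assms
  by (induction rule: polys_of_induct) (auto simp: monomial_fun_scaleR algebra_simps)

text \<open>For \<open>a i = 0\<close> the truncated exponent is harmless because of the factor \<open>a i\<close>.\<close>

lemma monomial_has_partial:
  fixes x :: "real ^ 'd::finite"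
  shows "((\<lambda>t. monomial_fun a (x + t *\<^sub>R axis i 1)) has_real_derivative
     real (a i) * monomial_fun (a(i := a i - 1)) x) (at 0)"
proof -
  have split: "monomial_fun b y = (y $ i) ^ b i * (\<Prod>j\<in>UNIV - {i}. (y $ j) ^ b j)" for b and y :: "real ^ 'd"
    unfolding monomial_fun_def by (subst prod.remove[of _ i]) auto
  have "(\<lambda>t. monomial_fun a (x + t *\<^sub>R axis i 1)) = (\<lambda>t. (x $ i + t) ^ a i * (\<Prod>j\<in>UNIV - {i}. (x $ j) ^ a j))"
    unfolding split by (auto simp: axis_def intro!: ext prod.cong)
  moreover have "real (a i) * monomial_fun (a(i := a i - 1)) x =
     real (a i) * (x $ i) ^ (a i - 1) * (\<Prod>j\<in>UNIV - {i}. (x $ j) ^ a j)"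
    unfolding split by (auto intro!: prod.cong)
  moreover have "((\<lambda>t. (x $ i + t) ^ a i * (\<Prod>j\<in>UNIV - {i}. (x $ j) ^ a j)) has_real_derivative
      real (a i) * (x $ i) ^ (a i - 1) * (\<Prod>j\<in>UNIV - {i}. (x $ j) ^ a j)) (at 0)"
    by (auto intro!: derivative_eq_intros)
  ultimately show ?thesis by (simp only:)
qed

section \<open>Partial derivatives, Euler operator and Laplacian of polynomial functions\<close>

lemma partial_eqI:
  "((\<lambda>t. f (x + t *\<^sub>R axis i 1)) has_real_derivative D) (at 0) \<Longrightarrow> partial i f x = D"
  by (simp add: partial_def DERIV_imp_deriv)

text \<open>\<open>deriv\<close> is informative only where a derivative exists; the sum and product
  rules for \<open>partial\<close> rest on this existence statement.\<close>

lemma polys_has_partial: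
  assumes "f \<in> polys_of A"
  shows "((\<lambda>t. f (x + t *\<^sub>R axis i 1)) has_real_derivative partial i f x) (at 0)"
proof -
  have "\<exists>D. ((\<lambda>t. f (x + t *\<^sub>R axis i 1)) has_real_derivative D) (at 0)"
    using assms
  proof (induction rule: polys_of_induct)
    case zero
    then show ?case by (auto intro!: exI derivative_eq_intros)
  next
    case (add c a g)
    then obtain D where D: "((\<lambda>t. g (x + t *\<^sub>R axis i 1)) has_real_derivative D) (at 0)" by blast
    show ?case by (rule exI, rule DERIV_add[OF DERIV_cmult[OF monomial_has_partial] D])
  qed
  then obtain D where "((\<lambda>t. f (x + t *\<^sub>R axis i 1)) has_real_derivative D) (at 0)" ..
  then show ?thesis using partial_eqI by fastforce
qed

lemma partial_const: "partial i (\<lambda>x. c) x = 0"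
  by (rule partial_eqI) auto

lemma partial_add:
  "f \<in> polys_of A \<Longrightarrow> g \<in> polys_of B \<Longrightarrow> partial i (\<lambda>x. f x + g x) x = partial i f x + partial i g x"
  by (intro partial_eqI DERIV_add polys_has_partial)

lemma partial_cmult: "f \<in> polys_of A \<Longrightarrow> partial i (\<lambda>x. c * f x) x = c * partial i f x"
  by (intro partial_eqI DERIV_cmult polys_has_partial)

lemma partial_mult:
  "f \<in> polys_of A \<Longrightarrow> g \<in> polys_of B \<Longrightarrow>
     partial i (\<lambda>x. f x * g x) x = partial i f x * g x + f x * partial i g x"
  using DERIV_mult[OF polys_has_partial[of f A x i] polys_has_partial[of g B x i]]
  by (intro partial_eqI) (simp add: algebra_simps)

lemma partial_component: "partial i (\<lambda>x. x $ j) x = (if i = j then 1 else 0)"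
  by (rule partial_eqI) (auto simp: axis_def intro!: derivative_eq_intros)

lemma partial_monomial: "partial i (monomial_fun a) x = real (a i) * monomial_fun (a(i := a i - 1)) x"
  by (intro partial_eqI monomial_has_partial)

text \<open>Degree 0 imposes no condition on \<open>B\<close>, since constants have derivative zero.
  With \<open>A = {0}\<close> and \<open>B = {}\<close> the rule therefore says that the derivative
  vanishes, a form used repeatedly below.\<close>

lemma partial_polys:
  assumes "f \<in> polys_of A" and AB: "\<And>m. m \<in> A \<Longrightarrow> m > 0 \<Longrightarrow> m - 1 \<in> B"
  shows "partial i f \<in> polys_of B"
  using assms(1)
proof (induction rule: polys_of_induct)
  case zero
  have "partial i (\<lambda>x. 0) = (\<lambda>x. 0)" by (simp add: partial_const fun_eq_iff)
  then show ?case by simp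
next
  case (add c a g)
  have eq: "partial i (\<lambda>x. c * monomial_fun a x + g x)
      = (\<lambda>x. (c * real (a i)) * monomial_fun (a(i := a i - 1)) x + partial i g x)"
  proof
    fix x
    have m: "monomial_fun a \<in> polys_of UNIV" by (rule polys_of_monomial) simp
    show "partial i (\<lambda>x. c * monomial_fun a x + g x) x =
        (c * real (a i)) * monomial_fun (a(i := a i - 1)) x + partial i g x"
      by (simp add: partial_add[OF polys_of_cmult[OF m] add.hyps(2)] partial_cmult[OF m] partial_monomial)
  qed
  have "(\<lambda>x. (c * real (a i)) * monomial_fun (a(i := a i - 1)) x) \<in> polys_of B"
  proof (cases "a i = 0")
    case False
    have "(\<Sum>j\<in>UNIV. (a(i := a i - 1)) j) = (\<Sum>j\<in>UNIV. a j) - 1"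
    proof -
      have "(\<Sum>j\<in>UNIV - {i}. (a(i := a i - 1)) j) = (\<Sum>j\<in>UNIV - {i}. a j)"
        by (intro sum.cong) auto
      then show ?thesis
        using False sum.remove[of UNIV i a] sum.remove[of UNIV i "a(i := a i - 1)"] by simp
    qed
    moreover have "(\<Sum>j\<in>UNIV. a j) > 0"
      using False by (simp add: sum.remove[of UNIV i a])
    ultimately show ?thesis
      using AB add.hyps by (intro polys_of_cmult polys_of_monomial) auto
  qed simp
  then show ?case
    unfolding eq using add.IH by (intro polys_of_add)
qed

lemma partial_polys_UNIV: "f \<in> polys_of A \<Longrightarrow> partial i f \<in> polys_of UNIV"
  by (rule partial_polys) auto

text \<open>Euler's identity: multiplication by \<open>x $ i\<close> restores the exponent lowered
  by \<open>partial i\<close>, so each monomial returns with the sum of its exponents as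
  factor.\<close>

lemma euler_homogeneous:
  assumes "f \<in> polys_of {m}"
  shows "euler_op f x = m * f x"
  using assms
proof (induction rule: polys_of_induct)
  case zero
  show ?case by (simp add: euler_op_def partial_const)
next
  case (add c a g)
  have m: "monomial_fun a \<in> polys_of UNIV" by (rule polys_of_monomial) simp
  have "x $ i * (real (a i) * monomial_fun (a(i := a i - 1)) x) = real (a i) * monomial_fun a x" for i
  proof (cases "a i")
    case (Suc l)
    have split: "monomial_fun b x = (x $ i) ^ b i * (\<Prod>j\<in>UNIV - {i}. (x $ j) ^ b j)" for b
      unfolding monomial_fun_def by (subst prod.remove[of _ i]) auto
    have "(\<Prod>j\<in>UNIV - {i}. (x $ j) ^ (a(i := a i - 1)) j) = (\<Prod>j\<in>UNIV - {i}. (x $ j) ^ a j)"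
      by (intro prod.cong) auto
    then show ?thesis unfolding split by (simp add: Suc)
  qed auto
  then have "(\<Sum>i\<in>UNIV. x $ i * partial i (monomial_fun a) x) = real m * monomial_fun a x"
    using add.hyps unfolding partial_monomial
    by (simp only: sum_distrib_right[symmetric] singleton_iff flip: of_nat_sum)
  then show ?case
    using add.IH
    by (simp add: euler_op_def partial_add[OF polys_of_cmult[OF m] add.hyps(2)] partial_cmult[OF m]
        ring_distribs sum.distrib mult.left_commute[of _ c] flip: sum_distrib_left)
qed

lemma laplacian_add:
  assumes "f \<in> polys_of A" "g \<in> polys_of B"
  shows "laplacian (\<lambda>x. f x + g x) x = laplacian f x + laplacian g x"
proof -
  have "partial i (\<lambda>x. f x + g x) = (\<lambda>x. partial i f x + partial i g x)" for i
    using partial_add[OF assms] by blast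
  then show ?thesis
    by (simp add: laplacian_def sum.distrib
        partial_add[OF partial_polys_UNIV[OF assms(1)] partial_polys_UNIV[OF assms(2)]])
qed

lemma laplacian_cmult:
  assumes "f \<in> polys_of A"
  shows "laplacian (\<lambda>x. c * f x) x = c * laplacian f x"
proof -
  have "partial i (\<lambda>x. c * f x) = (\<lambda>x. c * partial i f x)" for i
    using partial_cmult[OF assms] by blast
  then show ?thesis
    by (simp add: laplacian_def sum_distrib_left partial_cmult[OF partial_polys_UNIV[OF assms]])
qed

lemma laplacian_mult:
  assumes "f \<in> polys_of A" "g \<in> polys_of B"
  shows "laplacian (\<lambda>x. f x * g x) x =
    laplacian f x * g x + 2 * (\<Sum>i\<in>UNIV. partial i f x * partial i g x) + f x * laplacian g x"
proof -
  note f = polys_of_UNIV[OF assms(1)] and g = polys_of_UNIV[OF assms(2)]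
  note df = partial_polys_UNIV[OF f] and dg = partial_polys_UNIV[OF g]
  have "partial i (\<lambda>x. f x * g x) = (\<lambda>x. partial i f x * g x + f x * partial i g x)" for i
    using partial_mult[OF assms] by blast
  then have "partial i (partial i (\<lambda>x. f x * g x)) x =
      partial i (partial i f) x * g x + 2 * (partial i f x * partial i g x) + f x * partial i (partial i g) x" for i
    by (simp add: partial_add[OF polys_of_UNIV_mult[OF df g] polys_of_UNIV_mult[OF f dg]]
        partial_mult[OF df g] partial_mult[OF f dg])
  then show ?thesis
    by (simp add: laplacian_def sum.distrib sum_distrib_left sum_distrib_right)
qed

lemma laplacian_polys:
  assumes "f \<in> polys_of A" and AB: "\<And>m. m \<in> A \<Longrightarrow> m > 1 \<Longrightarrow> m - 2 \<in> B"
  shows "laplacian f \<in> polys_of B"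
proof -
  \<comment> \<open>The intermediate set consists of the degrees one below those in
    \<open>A\<close>, where the first derivative lives.\<close>
  have "partial i (partial i f) \<in> polys_of B" for i
    by (rule partial_polys[OF partial_polys[OF assms(1), of "{m. m + 1 \<in> A}"]])
       (use AB in \<open>auto simp: numeral_2_eq_2 dest: AB\<close>)
  then show ?thesis unfolding laplacian_def[abs_def] by (intro polys_of_sum)
qed

section \<open>Radial factors times homogeneous polynomials\<close>

lemma partial_radial:
  "partial i (\<lambda>x :: real ^ 'd::finite. poly g ((norm x)\<^sup>2)) x = 2 * x $ i * poly (pderiv g) ((norm x)\<^sup>2)"
proof (rule partial_eqI)
  have eq: "(norm (x + t *\<^sub>R axis i 1))\<^sup>2 = (norm x)\<^sup>2 + 2 * x $ i * t + t\<^sup>2" for t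
    unfolding power2_norm_eq_inner
    by (simp add: inner_add_left inner_add_right inner_axis inner_axis' inner_axis_axis power2_eq_square algebra_simps)
  show "((\<lambda>t. poly g ((norm (x + t *\<^sub>R axis i 1))\<^sup>2)) has_real_derivative
          2 * x $ i * poly (pderiv g) ((norm x)\<^sup>2)) (at 0)"
    unfolding eq by (rule DERIV_cong[OF DERIV_chain2[OF poly_DERIV]]) (auto intro!: derivative_eq_intros)
qed

lemma laplacian_radial:
  "laplacian (\<lambda>x :: real ^ 'd::finite. poly g ((norm x)\<^sup>2)) x =
     4 * (norm x)\<^sup>2 * poly (pderiv (pderiv g)) ((norm x)\<^sup>2) + 2 * real CARD('d) * poly (pderiv g) ((norm x)\<^sup>2)"
proof -
  have "partial i (\<lambda>x :: real ^ 'd::finite. poly g ((norm x)\<^sup>2)) =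
      (\<lambda>x. (2 * x $ i) * poly (pderiv g) ((norm x)\<^sup>2))" for i
    by (intro ext) (simp add: partial_radial)
  moreover have "partial i (\<lambda>x. (2 * x $ i) * poly (pderiv g) ((norm x)\<^sup>2)) x =
      2 * poly (pderiv g) ((norm x)\<^sup>2) + 4 * (x $ i * x $ i) * poly (pderiv (pderiv g)) ((norm x)\<^sup>2)" for i
    by (subst partial_mult[OF polys_of_cmult[OF polys_of_component[of UNIV]] polys_of_radial])
       (simp_all add: partial_radial partial_cmult[OF polys_of_component[of UNIV]] partial_component)
  ultimately show ?thesis
    unfolding laplacian_def by (simp add: sum.distrib norm_sq_vec sum_distrib_left[symmetric] sum_distrib_right[symmetric])
qed

text \<open>The mixed term of the product rule is a radial factor times \<open>euler_op Y\<close>,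
  which homogeneity turns into a multiple of \<open>Y\<close>. Its effect on the radial part is that
  of raising the dimension from d to d + 2m.\<close>

lemma laplacian_radial_mult:
  fixes Y :: "real ^ 'd::finite \<Rightarrow> real"
  assumes "Y \<in> polys_of {m}"
  shows "laplacian (\<lambda>x. poly g ((norm x)\<^sup>2) * Y x) x =
    (4 * (norm x)\<^sup>2 * poly (pderiv (pderiv g)) ((norm x)\<^sup>2)
      + (2 * real CARD('d) + 4 * real m) * poly (pderiv g) ((norm x)\<^sup>2)) * Y x
    + poly g ((norm x)\<^sup>2) * laplacian Y x"
proof -
  have "(\<Sum>i\<in>UNIV. partial i (\<lambda>x. poly g ((norm x)\<^sup>2)) x * partial i Y x)
      = 2 * poly (pderiv g) ((norm x)\<^sup>2) * euler_op Y x"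
    by (simp add: partial_radial euler_op_def sum_distrib_left algebra_simps)
  then show ?thesis
    unfolding laplacian_mult[OF polys_of_radial assms] laplacian_radial euler_homogeneous[OF assms]
    by (simp add: algebra_simps)
qed

lemma euler_radial_mult:
  fixes Y :: "real ^ 'd::finite \<Rightarrow> real"
  assumes "Y \<in> polys_of {m}"
  shows "euler_op (\<lambda>x. poly g ((norm x)\<^sup>2) * Y x) x =
    (2 * (norm x)\<^sup>2 * poly (pderiv g) ((norm x)\<^sup>2) + real m * poly g ((norm x)\<^sup>2)) * Y x"
proof -
  have "euler_op (\<lambda>x. poly g ((norm x)\<^sup>2) * Y x) x
      = (\<Sum>i\<in>UNIV. 2 * poly (pderiv g) ((norm x)\<^sup>2) * Y x * (x $ i * x $ i))
        + poly g ((norm x)\<^sup>2) * euler_op Y x"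
    unfolding euler_op_def partial_mult[OF polys_of_radial assms] partial_radial
    by (simp add: sum.distrib sum_distrib_left algebra_simps)
  then show ?thesis
    unfolding euler_homogeneous[OF assms] sum_distrib_left[symmetric] norm_sq_vec[symmetric]
    by (simp add: algebra_simps)
qed

section \<open>Decomposition of homogeneous polynomials into harmonics\<close>

lemma harmonic_polysD:
  assumes "Y \<in> harmonic_polys m"
  shows "Y \<in> polys_of {m}" "laplacian Y x = 0"
  using assms by (auto simp: harmonic_polys_def homogeneous_polys_eq)

text \<open>The building blocks of the classical decomposition of homogeneous polynomials. The
  condition \<open>2 * k \<le> m\<close> keeps the subtraction on naturals exact, so each product is
  homogeneous of degree \<open>m\<close>.\<close>

definition solid_harmonic_products :: "nat \<Rightarrow> (real ^ 'd::finite \<Rightarrow> real) set" where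
  "solid_harmonic_products m =
     {(\<lambda>x. ((norm x)\<^sup>2) ^ k * Y x) | k Y. 2 * k \<le> m \<and> Y \<in> harmonic_polys (m - 2 * k)}"

text \<open>The Laplacian maps \<open>|x|\<^sup>2\<^sup>k\<^sup>+\<^sup>2 Y\<close> to a positive multiple of \<open>|x|\<^sup>2\<^sup>k Y\<close>, so a decomposition of
  \<open>\<Delta>f\<close> can be lifted to \<open>f\<close> up to a harmonic remainder.\<close>

lemma homogeneous_polys_decomposition:
  "polys_of {m} \<subseteq> span (solid_harmonic_products m :: (real ^ 'd::finite \<Rightarrow> real) set)"
proof (induction m rule: less_induct)
  case (less m)
  have lift: "\<exists>h. h \<in> span (solid_harmonic_products m) \<and> h \<in> polys_of {m} \<and> (\<forall>x. laplacian h x = g x)"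
    if "m > 1" "g \<in> span (solid_harmonic_products (m - 2))" for g :: "real ^ 'd \<Rightarrow> real"
    using that(2)
  proof (induction rule: span_induct_alt)
    case base
    have "(0 :: real ^ 'd \<Rightarrow> real) = (\<lambda>x. 0)" by (simp add: zero_fun_def)
    moreover have "laplacian (\<lambda>x. 0) x = 0" for x :: "real ^ 'd"
      by (simp add: laplacian_def partial_const[abs_def])
    ultimately show ?case using span_zero polys_of_zero by (metis zero_fun_def)
  next
    case (step c f g)
    obtain h where h: "h \<in> span (solid_harmonic_products m)" "h \<in> polys_of {m}" "\<And>x. laplacian h x = g x"
      using step.IH by blast
    obtain k Y where kY: "f = (\<lambda>x. ((norm x)\<^sup>2) ^ k * Y x)" "2 * k \<le> m - 2" "Y \<in> harmonic_polys (m - 2 - 2 * k)"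
      using step.hyps unfolding solid_harmonic_products_def by blast
    define l where "l = m - 2 - 2 * k"
    have Y: "Y \<in> polys_of {l}" "\<And>x. laplacian Y x = 0"
      using harmonic_polysD[OF kY(3)] by (auto simp: l_def)
    \<comment> \<open>With s = |x|^2, the radial formula sends s^(k+1) Y to (4k(k+1) + (2d +
      4l)(k+1)) s^k Y; \<open>e\<close> is this factor.\<close>
    define e where "e = real (k + 1) * (4 * real k + 2 * real CARD('d) + 4 * real l)"
    have "CARD('d) > 0" by simp
    then have e: "e \<noteq> 0" unfolding e_def by (simp add: add_nonneg_eq_0_iff)
    define F where "F = (\<lambda>x :: real ^ 'd. ((norm x)\<^sup>2) ^ Suc k * Y x)"
    have F: "F \<in> solid_harmonic_products m"
      unfolding F_def solid_harmonic_products_def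
      using kY \<open>m > 1\<close> by (auto intro!: exI[of _ "Suc k"] exI[of _ Y])
    have Fp: "F \<in> polys_of {m}"
      unfolding F_def using Y(1) kY(2) \<open>m > 1\<close>
      by (intro polys_of_mult[OF polys_of_norm_sq_power[of _ "{2 * Suc k}"]]) (auto simp: l_def)
    have lapF: "laplacian F x = e * f x" for x
    proof -
      have "F = (\<lambda>x. poly (monom 1 (Suc k)) ((norm x)\<^sup>2) * Y x)"
        by (simp add: F_def poly_monom)
      moreover have "4 * (norm x)\<^sup>2 * poly (pderiv (pderiv (monom 1 (Suc k)))) ((norm x)\<^sup>2)
         + (2 * real CARD('d) + 4 * real l) * poly (pderiv (monom 1 (Suc k))) ((norm x)\<^sup>2)
         = e * ((norm x)\<^sup>2) ^ k"
        by (cases k) (simp_all add: e_def pderiv_monom poly_monom algebra_simps)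
      ultimately show ?thesis
        using laplacian_radial_mult[OF Y(1), of "monom 1 (Suc k)" x] by (simp add: Y(2) kY(1))
    qed
    define h' where "h' = (\<lambda>x. (c / e) * F x + h x)"
    have "h' = (c / e) *\<^sub>R F + h" by (simp add: h'_def scaleR_fun_def plus_fun_def)
    then have "h' \<in> span (solid_harmonic_products m)"
      using F h(1) by (simp add: span_add span_scale span_base)
    moreover have "h' \<in> polys_of {m}"
      unfolding h'_def by (intro polys_of_add polys_of_cmult Fp h)
    moreover have "laplacian h' x = (c *\<^sub>R f + g) x" for x
      unfolding h'_def laplacian_add[OF polys_of_cmult[OF Fp] h(2)] laplacian_cmult[OF Fp] lapF h(3)
      using e by (simp add: scaleR_fun_def)
    ultimately show ?case by blast
  qed
  show ?case
  proof
    fix f :: "real ^ 'd \<Rightarrow> real"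
    assume f: "f \<in> polys_of {m}"
    have harm: "g \<in> span (solid_harmonic_products m)" if "g \<in> polys_of {m}" "\<And>x. laplacian g x = 0"
      for g :: "real ^ 'd \<Rightarrow> real"
    proof -
      have "g \<in> harmonic_polys m"
        using that by (simp add: harmonic_polys_def homogeneous_polys_eq)
      then have "g \<in> solid_harmonic_products m"
        unfolding solid_harmonic_products_def by (intro CollectI exI[of _ 0] exI[of _ g]) auto
      then show ?thesis by (rule span_base)
    qed
    show "f \<in> span (solid_harmonic_products m)"
    proof (cases "m > 1")
      case True
      have "laplacian f \<in> polys_of {m - 2}"
        using f by (rule laplacian_polys) auto
      then have "laplacian f \<in> span (solid_harmonic_products (m - 2))"
        using less[of "m - 2"] True by auto
      then obtain h where h: "h \<in> span (solid_harmonic_products m)" "h \<in> polys_of {m}"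
          "\<And>x. laplacian h x = laplacian f x"
        using lift True by blast
      have "(\<lambda>x. f x + (-1) * h x) \<in> span (solid_harmonic_products m)"
      proof (rule harm)
        show "(\<lambda>x. f x + (-1) * h x) \<in> polys_of {m}"
          by (intro f h polys_of_add polys_of_cmult)
        show "laplacian (\<lambda>x. f x + (-1) * h x) x = 0" for x
          unfolding laplacian_add[OF f polys_of_cmult[OF h(2)]] laplacian_cmult[OF h(2)] by (simp add: h(3))
      qed
      then have "(\<lambda>x. f x + (-1) * h x) + h \<in> span (solid_harmonic_products m)"
        using h(1) by (rule span_add)
      then show ?thesis by (simp add: plus_fun_def)
    next
      case False
      \<comment> \<open>In degree at most one no degree survives two derivatives, so
        \<open>f\<close> is itself harmonic.\<close>
      have "laplacian f \<in> polys_of {}"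
        using f by (rule laplacian_polys) (use False in auto)
      then show ?thesis
        using f by (intro harm) (auto simp: polys_of_def zero_fun_def)
    qed
  qed
qed

section \<open>Jacobi polynomials\<close>

lemma set_integrable_bounded:
  fixes f :: "'a::euclidean_space \<Rightarrow> real"
  assumes "f \<in> borel_measurable borel" "S \<in> sets borel" "bounded S" "\<And>x. x \<in> S \<Longrightarrow> \<bar>f x\<bar> \<le> C"
  shows "set_integrable lborel S f"
proof -
  have "integrable lborel (\<lambda>x. indicator S x *\<^sub>R C)"
    using emeasure_bounded_finite[OF assms(3)] assms(2)
    by (intro integrable_scaleR_left integrable_real_indicator) auto
  then show ?thesis
    unfolding set_integrable_def
  proof (rule Bochner_Integration.integrable_bound)
    show "(\<lambda>x. indicator S x *\<^sub>R f x) \<in> borel_measurable lborel"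
      using assms(1,2) by measurable
    show "AE x in lborel. norm (indicator S x *\<^sub>R f x) \<le> norm (indicator S x *\<^sub>R C)"
      using assms(4) by (intro AE_I2) (auto simp: indicator_def intro: order.trans[OF _ abs_ge_self])
  qed
qed

section \<open>Integrals against the Jacobi weight\<close>

definition jac_int :: "real \<Rightarrow> real poly \<Rightarrow> real" where
  "jac_int \<beta> f = (LINT t:{-1..1}|lborel. poly f t * (1 + t) powr \<beta>)"

lemma jac_integrable:
  fixes f :: "real poly"
  assumes "\<beta> \<ge> 0"
  shows "set_integrable lborel {-1..1} (\<lambda>t. poly f t * (1 + t) powr \<beta>)"
proof -
  have "bounded (poly f ` {-1..1})"
    by (intro compact_imp_bounded compact_continuous_image continuous_intros) auto
  then obtain C where C: "\<And>t. t \<in> {-1..1} \<Longrightarrow> \<bar>poly f t\<bar> \<le> C"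
    unfolding bounded_iff by (metis (no_types, lifting) imageI real_norm_def)
  have [measurable]: "poly f \<in> borel_measurable borel"
    by (intro borel_measurable_continuous_onI continuous_intros)
  show ?thesis
  proof (rule set_integrable_bounded)
    show "\<bar>poly f t * (1 + t) powr \<beta>\<bar> \<le> C * 2 powr \<beta>" if "t \<in> {-1..1}" for t
    proof -
      have "\<bar>poly f t\<bar> * (1 + t) powr \<beta> \<le> C * 2 powr \<beta>"
        using that C[OF that] assms by (intro mult_mono powr_mono2) auto
      then show ?thesis by (simp add: abs_mult)
    qed
  qed (auto simp: bounded_closed_interval)
qed

lemma jac_int_add: "\<beta> \<ge> 0 \<Longrightarrow> jac_int \<beta> (f + g) = jac_int \<beta> f + jac_int \<beta> g"
  using set_integral_add(2)[OF jac_integrable[of \<beta> f] jac_integrable[of \<beta> g]]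
  by (simp add: jac_int_def algebra_simps)

lemma jac_int_smult: "jac_int \<beta> (smult c f) = c * jac_int \<beta> f"
  by (simp add: jac_int_def mult.assoc)

lemma jac_int_sum: "\<beta> \<ge> 0 \<Longrightarrow> jac_int \<beta> (\<Sum>i\<in>I. f i) = (\<Sum>i\<in>I. jac_int \<beta> (f i))"
proof (induction I rule: infinite_finite_induct)
  case empty
  then show ?case using jac_int_smult[of \<beta> 0 0] by simp
next
  case (infinite A)
  then show ?case using jac_int_smult[of \<beta> 0 0] by simp
qed (simp add: jac_int_add)

text \<open>The integrand is the derivative of (1 + t)^(\<beta> + 1) f, whose value at -1 is zero.
  The derivative is taken in the open interval only, as the power need not be smooth at -1. Every
  value of \<open>jac_int\<close> below comes from here.\<close>

lemma jac_int_by_parts: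
  assumes "\<beta> \<ge> 0"
  shows "jac_int \<beta> (smult (\<beta> + 1) f + [:1, 1:] * pderiv f) = 2 powr (\<beta> + 1) * poly f 1"
proof -
  let ?g = "smult (\<beta> + 1) f + [:1, 1:] * pderiv f"
  define F where "F t = (1 + t) powr (\<beta> + 1) * poly f t" for t
  have "((\<lambda>t. poly ?g t * (1 + t) powr \<beta>) has_integral (F 1 - F (-1))) {-1..1}"
  proof (rule fundamental_theorem_of_calculus_interior)
    show "continuous_on {-1..1} F"
      unfolding F_def using assms by (intro continuous_intros continuous_on_powr') auto
    fix t :: real assume t: "t \<in> {-1<..<1}"
    have "(F has_real_derivative (\<beta> + 1) * (1 + t) powr \<beta> * poly f t + (1 + t) powr (\<beta> + 1) * poly (pderiv f) t) (at t)"
      unfolding F_def using t by (auto intro!: derivative_eq_intros)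
    moreover have "(1 + t) powr (\<beta> + 1) = (1 + t) * (1 + t) powr \<beta>"
      using t by (simp add: powr_add)
    ultimately show "(F has_vector_derivative poly ?g t * (1 + t) powr \<beta>) (at t)"
      by (simp add: has_real_derivative_iff_has_vector_derivative algebra_simps)
  qed simp
  then have "integral {-1..1} (\<lambda>t. poly ?g t * (1 + t) powr \<beta>) = 2 powr (\<beta> + 1) * poly f 1"
    unfolding F_def by (simp add: integral_unique)
  then show ?thesis
    unfolding jac_int_def using set_borel_integral_eq_integral(2)[OF jac_integrable[OF assms, of ?g]] by simp
qed

text \<open>The weight is positive inside the interval and a nonzero polynomial has finitely many
  roots, so a zero integral would make the interval a null set.\<close>

lemma jac_int_square_eq_0:
  assumes "\<beta> \<ge> 0" "jac_int \<beta> (f * f) = 0"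
  shows "f = 0"
proof (rule ccontr)
  assume "f \<noteq> 0"
  define h where "h t = indicator {-1..1} t *\<^sub>R (poly (f * f) t * (1 + t) powr \<beta>)" for t :: real
  have "integrable lborel h" "integral\<^sup>L lborel h = 0"
    using jac_integrable[OF assms(1), of "f * f"] assms(2)
    unfolding h_def set_integrable_def jac_int_def set_lebesgue_integral_def by auto
  then have "AE t in lborel. h t = 0"
    by (subst (asm) integral_nonneg_eq_0_iff_AE) (auto simp: h_def indicator_def)
  then have "AE t in lborel. t \<in> {-1<..<1} \<longrightarrow> poly f t = 0"
    by eventually_elim (auto simp: h_def)
  moreover have "AE t in lborel. t \<notin> {t. poly f t = 0}"
    using poly_roots_finite[OF \<open>f \<noteq> 0\<close>]
    by (intro AE_not_in finite_imp_null_set_lborel)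
  ultimately have "AE t in lborel. t \<notin> {-1<..<1::real}"
    by eventually_elim auto
  then have "emeasure lborel {-1<..<1::real} = 0"
    by (subst (asm) AE_iff_measurable[of "{-1<..<1}"]) auto
  then show False by (simp add: emeasure_lborel_Ioo del: greaterThanLessThan_iff)
qed

lemma pcompose_altdef: "pcompose g (p :: real poly) = (\<Sum>i\<le>degree g. smult (coeff g i) (p ^ i))"
  by (rule poly_ext) (simp add: poly_pcompose poly_altdef[of g] poly_sum)

text \<open>Taylor expansion about \<open>- a\<close>, obtained by shifting the variable and
  shifting back. For \<open>a = 1\<close> the powers are those of 1 + t, which suit both the weight
  and the substitution t = 2|x|^2 - 1.\<close>

lemma poly_expand_at:
  fixes f :: "real poly"
  obtains c where "f = (\<Sum>i\<le>degree f. smult (c i) ([:a, 1:] ^ i))"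
proof
  have "f = pcompose (pcompose f [:- a, 1:]) [:a, 1:]"
    by (rule poly_ext) (simp add: poly_pcompose)
  also have "\<dots> = (\<Sum>i\<le>degree f. smult (coeff (pcompose f [:- a, 1:]) i) ([:a, 1:] ^ i))"
    by (subst pcompose_altdef) (simp add: degree_pcompose)
  finally show "f = (\<Sum>i\<le>degree f. smult (coeff (pcompose f [:- a, 1:]) i) ([:a, 1:] ^ i))" .
qed

section \<open>Eigenpolynomials of the Jacobi operator\<close>

definition jac_eig :: "real \<Rightarrow> nat \<Rightarrow> real" where
  "jac_eig \<beta> k = real k * (real k + \<beta> + 1)"

lemma jac_eig_less:
  assumes "\<beta> \<ge> 0" "j < k"
  shows "jac_eig \<beta> j < jac_eig \<beta> k"
  unfolding jac_eig_def using assms by (intro mult_strict_mono') auto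

text \<open>The Jacobi operator for \<alpha> = 0. In divergence form it is f' multiplied by (1 -
  t)(1 + t)^(\<beta> + 1), differentiated and divided by (1 + t)^\<beta>; hence its symmetry for the
  weight.\<close>

definition jac_op :: "real \<Rightarrow> real poly \<Rightarrow> real poly" where
  "jac_op \<beta> f = [:1, 0, -1:] * pderiv (pderiv f) + [:\<beta>, - (\<beta> + 2):] * pderiv f"

lemma jac_op_by_parts:
  assumes "\<beta> \<ge> 0"
  shows "jac_int \<beta> (jac_op \<beta> f * g) = - jac_int \<beta> ([:1, 0, -1:] * pderiv f * pderiv g)"
proof -
  \<comment> \<open>The factor 1 - t removes the boundary term at 1, and what remains is symmetric
    in \<open>f\<close> and \<open>g\<close>.\<close>
  let ?h = "[:1, -1:] * pderiv f * g"
  have "smult (\<beta> + 1) ?h + [:1, 1:] * pderiv ?h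
     = jac_op \<beta> f * g + [:1, 0, -1:] * pderiv f * pderiv g"
    unfolding jac_op_def pderiv_mult
    by (rule poly_ext) (simp add: pderiv_pCons algebra_simps)
  then show ?thesis
    using jac_int_by_parts[OF assms, of ?h]
      jac_int_add[OF assms, of "jac_op \<beta> f * g" "[:1, 0, -1:] * pderiv f * pderiv g"] by simp
qed

lemma jac_op_symmetric:
  "\<beta> \<ge> 0 \<Longrightarrow> jac_int \<beta> (jac_op \<beta> f * g) = jac_int \<beta> (f * jac_op \<beta> g)"
  using jac_op_by_parts[of \<beta> f g] jac_op_by_parts[of \<beta> g f] by (simp only: mult_ac)

lemma pderiv_linear_power:
  "pderiv ([:a, 1:] ^ l) = smult (real l) ([:a, 1:] ^ (l - 1))"
  by (cases l) (simp_all add: pderiv_power_Suc pderiv_pCons del: power_Suc)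

text \<open>On powers of 1 + t the operator is bidiagonal with diagonal entries
  \<open>- jac_eig \<beta> j\<close>. For \<open>j = 0\<close> both coefficients vanish, so the
  truncated exponent is harmless.\<close>

lemma jac_op_power:
  "jac_op \<beta> ([:1, 1:] ^ j) =
     smult (2 * real j * (real j + \<beta>)) ([:1, 1:] ^ (j - 1)) - smult (jac_eig \<beta> j) ([:1, 1:] ^ j)"
proof (rule poly_ext)
  fix t
  show "poly (jac_op \<beta> ([:1, 1:] ^ j)) t = poly (smult (2 * real j * (real j + \<beta>)) ([:1, 1:] ^ (j - 1))
      - smult (jac_eig \<beta> j) ([:1, 1:] ^ j)) t"
    unfolding jac_op_def pderiv_linear_power pderiv_smult
    by (cases j rule: nat.exhaust; cases "j - 1")
       (simp_all only: poly_mult poly_add poly_diff poly_smult poly_power poly_pCons poly_0,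
        simp_all add: jac_eig_def algebra_simps)
qed

text \<open>Symmetry moves the operator from \<open>p\<close> to the power of 1 + t; its lower-order
  term vanishes by induction, and the two distinct eigenvalues force the integral to be
  zero.\<close>

lemma jac_eigenpoly_orthogonal:
  assumes "\<beta> \<ge> 0" and eig: "jac_op \<beta> p = smult (- jac_eig \<beta> k) p" and "j < k"
  shows "jac_int \<beta> (p * [:1, 1:] ^ j) = 0"
  using \<open>j < k\<close>
proof (induction j)
  case 0
  have "jac_eig \<beta> k * jac_int \<beta> p = 0"
  proof -
    have "jac_op \<beta> 1 = 0" by (simp add: jac_op_def)
    then have "jac_int \<beta> (smult (- jac_eig \<beta> k) p) = jac_int \<beta> (smult 0 0)"
      using jac_op_symmetric[OF assms(1), of p 1] by (simp add: eig)
    then show ?thesis unfolding jac_int_smult by simp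
  qed
  then show ?case using jac_eig_less[OF assms(1) 0] by (auto simp: jac_eig_def)
next
  case (Suc j)
  let ?s = "[:1, 1:] :: real poly"
  have "p * jac_op \<beta> (?s ^ Suc j) =
      smult (2 * real (Suc j) * (real (Suc j) + \<beta>)) (p * ?s ^ j) + smult (- jac_eig \<beta> (Suc j)) (p * ?s ^ Suc j)"
    unfolding jac_op_power by (simp add: algebra_simps del: power_Suc)
  then have "jac_int \<beta> (jac_op \<beta> p * ?s ^ Suc j) = - jac_eig \<beta> (Suc j) * jac_int \<beta> (p * ?s ^ Suc j)"
    unfolding jac_op_symmetric[OF assms(1)] using Suc
    by (simp add: jac_int_add[OF assms(1)] jac_int_smult del: power_Suc mult_pCons_left mult_pCons_right smult_minus_left)
  moreover have "jac_op \<beta> p * ?s ^ Suc j = smult (- jac_eig \<beta> k) (p * ?s ^ Suc j)"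
    by (simp add: eig del: power_Suc)
  ultimately have "- jac_eig \<beta> k * jac_int \<beta> (p * ?s ^ Suc j) = - jac_eig \<beta> (Suc j) * jac_int \<beta> (p * ?s ^ Suc j)"
    by (simp only: jac_int_smult)
  then show ?case using jac_eig_less[OF assms(1) Suc.prems] by (simp del: power_Suc)
qed

text \<open>Power series solution of the Jacobi equation in \<open>u = 1 - t\<close>; the recurrence annihilates
  the coefficients beyond \<open>k\<close>.\<close>

definition jac_coeff :: "real \<Rightarrow> nat \<Rightarrow> nat \<Rightarrow> real" where
  "jac_coeff \<beta> k j = (\<Prod>i<j. (jac_eig \<beta> i - jac_eig \<beta> k) / (2 * (real i + 1)\<^sup>2))"

lemma jac_eigenpoly_exists:
  assumes "\<beta> \<ge> 0"
  obtains p where "degree p = k" "poly p 1 = 1" "jac_op \<beta> p = smult (- jac_eig \<beta> k) p"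
proof -
  define c where "c = jac_coeff \<beta> k"
  define P where "P = (\<Sum>j\<le>k. monom (c j) j)"
  have c0: "c j = 0" if "j > k" for j
    using that unfolding c_def jac_coeff_def by auto
  \<comment> \<open>The eigenvalues are strictly increasing, so no factor with index below
    \<open>k\<close> vanishes and the degree is exactly \<open>k\<close>.\<close>
  have ck: "c k \<noteq> 0"
    using jac_eig_less[OF assms] unfolding c_def jac_coeff_def by (auto simp: less_le)
  have rec: "2 * (real n + 1)\<^sup>2 * c (Suc n) = (jac_eig \<beta> n - jac_eig \<beta> k) * c n" for n
    by (simp add: c_def jac_coeff_def add_eq_0_iff)
  have cP: "coeff P j = c j" for j
    using c0[of j] by (auto simp: P_def coeff_sum)
  have degP: "degree P = k"
    using ck c0 by (intro antisym degree_le le_degree) (auto simp: cP)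
  \<comment> \<open>In u = 1 - t the coefficient 1 - t^2 is u(2 - u), and the first-order
    coefficient changes sign together with the derivative.\<close>
  have ode: "[:0, 2, -1:] * pderiv (pderiv P) + [:2, - (\<beta> + 2):] * pderiv P + smult (jac_eig \<beta> k) P = 0"
  proof (rule poly_eqI)
    fix n
    show "coeff ([:0, 2, -1:] * pderiv (pderiv P) + [:2, - (\<beta> + 2):] * pderiv P + smult (jac_eig \<beta> k) P) n = coeff 0 n"
      using rec[of n]
      by (cases n rule: nat.exhaust; cases "n - 1")
         (auto simp: coeff_pderiv cP coeff_pCons jac_eig_def algebra_simps power2_eq_square split: nat.splits)
  qed
  have ode': "u * (2 - u) * poly (pderiv (pderiv P)) u + (2 - (\<beta> + 2) * u) * poly (pderiv P) u = - jac_eig \<beta> k * poly P u" for u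
    using arg_cong[OF ode, of "\<lambda>f. poly f u"] by (simp add: algebra_simps)
  let ?p = "pcompose P [:1, -1:]"
  have d1: "pderiv (pcompose f [:1, -1:]) = smult (-1) (pcompose (pderiv f) [:1, -1:])" for f :: "real poly"
    by (simp add: pderiv_pcompose pderiv_pCons)
  show ?thesis
  proof (rule that[of ?p])
    show "degree ?p = k" by (simp add: degree_pcompose degP)
    have "poly P 0 = c 0" using cP[of 0] by (simp add: poly_0_coeff_0)
    then show "poly ?p 1 = 1" by (simp add: poly_pcompose c_def jac_coeff_def)
    show "jac_op \<beta> ?p = smult (- jac_eig \<beta> k) ?p"
    proof (rule poly_ext)
      fix t
      show "poly (jac_op \<beta> ?p) t = poly (smult (- jac_eig \<beta> k) ?p) t"
        using ode'[of "1 - t"] unfolding jac_op_def d1 pderiv_smult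
        by (simp add: poly_pcompose algebra_simps)
    qed
  qed
qed

text \<open>\<open>(1 - t) powr 0\<close> equals 1 except at t = 1, where
  \<open>0 powr 0 = 0\<close>; hence the integrands agree only almost everywhere.\<close>

lemma jacobi_weight_integral:
  "(LINT t:{-1..1}|lborel. poly p t * poly q t * ((1 - t) powr 0 * (1 + t) powr \<beta>)) = jac_int \<beta> (p * q)"
proof -
  have m: "poly f \<in> borel_measurable borel" for f :: "real poly"
    by (intro borel_measurable_continuous_onI continuous_intros)
  have "AE t in lborel. t \<noteq> (1::real)" by (rule AE_lborel_singleton)
  then show ?thesis
    unfolding jac_int_def set_lebesgue_integral_def using m[of p] m[of q] m[of "p * q"]
    by (intro integral_cong_AE, measurable) (rule eventually_mono, assumption, simp)
qed

text \<open>For uniqueness, two candidates are combined so that their leading terms cancel. The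
  combination has degree below \<open>k\<close>, is therefore orthogonal to itself, and vanishes;
  the value at 1 then fixes the factor.\<close>

lemma jacobi_eqI:
  assumes \<beta>: "\<beta> \<ge> 0" and p: "degree p = k" "poly p 1 = 1" "jac_op \<beta> p = smult (- jac_eig \<beta> k) p"
  shows "jacobi 0 \<beta> k = p"
proof -
  have gc: "(real k + 0) gchoose k = 1"
    by (simp add: binomial_gbinomial[symmetric])
  have orth: "jac_int \<beta> (p * q) = 0" if "degree q < k" for q
  proof -
    obtain c where "q = (\<Sum>i\<le>degree q. smult (c i) ([:1, 1:] ^ i))"
      by (rule poly_expand_at)
    then have "p * q = (\<Sum>i\<le>degree q. smult (c i) (p * [:1, 1:] ^ i))"
      by (metis (no_types, lifting) mult_smult_right sum.cong sum_distrib_left)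
    then show ?thesis
      using that jac_eigenpoly_orthogonal[OF \<beta> p(3)]
      by (simp add: jac_int_sum[OF \<beta>] jac_int_smult)
  qed
  show ?thesis
    unfolding jacobi_def jacobi_weight_integral gc
  proof (rule the_equality)
    show "degree p = k \<and> (\<forall>q. degree q < k \<longrightarrow> jac_int \<beta> (p * q) = 0) \<and> poly p 1 = 1"
      using p orth by auto
  next
    fix p' assume p': "degree p' = k \<and> (\<forall>q. degree q < k \<longrightarrow> jac_int \<beta> (p' * q) = 0) \<and> poly p' 1 = 1"
    define a where "a = coeff p k"
    define a' where "a' = coeff p' k"
    have "a \<noteq> 0" using p by (auto simp: a_def dest: leading_coeff_0_iff[THEN iffD1])
    define r where "r = smult a p' + smult (- a') p"
    have "degree r \<le> k" "coeff r k = 0"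
      using p p' by (auto intro!: degree_le simp: r_def a_def a'_def coeff_eq_0)
    \<comment> \<open>For \<open>k = 0\<close> no degree lies below \<open>k\<close>, and the
      vanishing coefficient alone gives \<open>r = 0\<close>.\<close>
    then have "r = 0 \<or> degree r < k"
      by (metis le_neq_implies_less leading_coeff_0_iff)
    moreover have "r = 0" if "degree r < k"
    proof -
      have "r * r = smult a (p' * r) + smult (- a') (p * r)"
        by (rule poly_ext) (simp add: r_def algebra_simps)
      then have "jac_int \<beta> (r * r) = a * jac_int \<beta> (p' * r) + - a' * jac_int \<beta> (p * r)"
        by (simp only: jac_int_add[OF \<beta>] jac_int_smult)
      then show ?thesis
        using p' orth that \<beta> by (intro jac_int_square_eq_0[of \<beta>]) auto
    qed
    ultimately have r: "r = 0" by blast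
    have "poly r 1 = a - a'" using p p' by (simp add: r_def)
    then have "a = a'" by (simp add: r)
    then have "smult a (p' - p) = 0" using r by (simp add: r_def smult_diff_right)
    then show "p' = p" using \<open>a \<noteq> 0\<close> by simp
  qed
qed

lemma
  assumes "\<beta> \<ge> 0"
  shows degree_jacobi: "degree (jacobi 0 \<beta> k) = k"
    and poly_jacobi_1: "poly (jacobi 0 \<beta> k) 1 = 1"
    and jac_op_jacobi: "jac_op \<beta> (jacobi 0 \<beta> k) = smult (- jac_eig \<beta> k) (jacobi 0 \<beta> k)"
  using jac_eigenpoly_exists[OF assms, of k] jacobi_eqI[OF assms, of _ k] by (metis)+

lemma jacobi_equation:
  assumes "\<beta> \<ge> 0"
  shows "(1 - t\<^sup>2) * poly (pderiv (pderiv (jacobi 0 \<beta> k))) t + (\<beta> - (\<beta> + 2) * t) * poly (pderiv (jacobi 0 \<beta> k)) t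
    = - jac_eig \<beta> k * poly (jacobi 0 \<beta> k) t"
  using arg_cong[OF jac_op_jacobi[OF assms, of k], of "\<lambda>f. poly f t"]
  by (simp add: jac_op_def algebra_simps power2_eq_square)

text \<open>\<open>jacobi_type\<close> already contains p', so a second-order operator applied to it
  produces p'''; this equation eliminates that term.\<close>

lemma jacobi_equation_deriv:
  fixes k :: nat
  assumes "\<beta> \<ge> 0"
  defines "D \<equiv> (pderiv :: real poly \<Rightarrow> real poly)"
  defines "p \<equiv> jacobi 0 \<beta> k"
  shows "(1 - t\<^sup>2) * poly (D (D (D p))) t + (\<beta> - (\<beta> + 4) * t) * poly (D (D p)) t
    = (\<beta> + 2 - jac_eig \<beta> k) * poly (D p) t"
  using arg_cong[OF jac_op_jacobi[OF assms(1), of k], of "\<lambda>f. poly (pderiv f) t"] unfolding D_def p_def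
  by (simp add: jac_op_def pderiv_mult pderiv_add pderiv_smult pderiv_minus pderiv_pCons algebra_simps power2_eq_square)

section \<open>The Jacobi-type polynomials\<close>

lemma jacobi_type_altdef:
  "jacobi_type \<beta> M k = smult (M + jac_eig \<beta> k) (jacobi 0 \<beta> k) - [:1, 1:] * pderiv (jacobi 0 \<beta> k)"
  by (simp add: jacobi_type_def jac_eig_def smult_add_left algebra_simps)

text \<open>The subtracted operator is \<open>jac_op\<close> plus (1 + t) d/dt, so the eigenvalue
  equation yields the definition of \<open>jacobi_type\<close> directly.\<close>

lemma jacobi_type_ladder_up:
  fixes k :: nat
  assumes "\<beta> \<ge> 0"
  defines "p \<equiv> jacobi 0 \<beta> k"
  shows "M * poly p t - ((1 - t\<^sup>2) * poly (pderiv (pderiv p)) t + (\<beta> + 1) * (1 - t) * poly (pderiv p) t)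
     = poly (jacobi_type \<beta> M k) t"
  using jacobi_equation[OF assms(1), of t k] unfolding jacobi_type_altdef p_def
  by (simp add: algebra_simps)

lemma jacobi_type_ladder_down:
  fixes k :: nat and M :: real
  assumes "\<beta> \<ge> 0"
  defines "q \<equiv> jacobi_type \<beta> M k"
  shows "(M + \<beta> + 1) * poly q t - ((1 - t\<^sup>2) * poly (pderiv (pderiv q)) t + (\<beta> + 1) * (1 - t) * poly (pderiv q) t)
     + 2 * (1 + t) * poly (pderiv q) t
     = (M + real k * (real k + \<beta>)) * (M + (real k + 1) * (real k + \<beta> + 1)) * poly (jacobi 0 \<beta> k) t"
proof -
  define K where "K = jac_eig \<beta> k"
  define p0 where "p0 = poly (jacobi 0 \<beta> k) t"
  define p1 where "p1 = poly (pderiv (jacobi 0 \<beta> k)) t"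
  define p2 where "p2 = poly (pderiv (pderiv (jacobi 0 \<beta> k))) t"
  define p3 where "p3 = poly (pderiv (pderiv (pderiv (jacobi 0 \<beta> k)))) t"
  have q0: "poly q t = (M + K) * p0 - (1 + t) * p1"
    by (simp add: q_def jacobi_type_altdef K_def p0_def p1_def algebra_simps)
  have q1: "poly (pderiv q) t = (M + K - 1) * p1 - (1 + t) * p2"
    unfolding q_def jacobi_type_altdef pderiv_diff pderiv_smult pderiv_mult K_def p1_def p2_def
    by (simp add: pderiv_pCons algebra_simps)
  have q2: "poly (pderiv (pderiv q)) t = (M + K - 2) * p2 - (1 + t) * p3"
    unfolding q_def jacobi_type_altdef pderiv_diff pderiv_smult pderiv_mult pderiv_add K_def p3_def p2_def
    by (simp add: pderiv_pCons pderiv_mult pderiv_add algebra_simps)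
  have e1: "(1 - t\<^sup>2) * p2 + (\<beta> - (\<beta> + 2) * t) * p1 + K * p0 = 0"
    using jacobi_equation[OF assms(1), of t k] by (simp add: p0_def p1_def p2_def K_def)
  have e2: "(1 - t\<^sup>2) * p3 + (\<beta> - (\<beta> + 4) * t) * p2 - (\<beta> + 2 - K) * p1 = 0"
    using jacobi_equation_deriv[OF assms(1), of t k] by (simp add: p1_def p2_def p3_def K_def)
  \<comment> \<open>The factors are M + K - k and M + K + k + \<beta> + 1. Their product depends on
    k only through K, since k(k + \<beta> + 1) is K again.\<close>
  have "(M + real k * (real k + \<beta>)) * (M + (real k + 1) * (real k + \<beta> + 1)) =
     (M + \<beta> + 1) * (M + K) + (M + K) * K - K"
    by (simp add: K_def jac_eig_def algebra_simps)
  \<comment> \<open>The difference of the two sides is a combination of the Jacobi equation and its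
    derivative. The multipliers 1 + t and 1 - M - K are read off from the coefficients of
    \<open>p3\<close> and \<open>p0\<close>.\<close>
  moreover have "(M + \<beta> + 1) * ((M + K) * p0 - (1 + t) * p1) - ((1 - t\<^sup>2) * ((M + K - 2) * p2 - (1 + t) * p3)
      + (\<beta> + 1) * (1 - t) * ((M + K - 1) * p1 - (1 + t) * p2)) + 2 * (1 + t) * ((M + K - 1) * p1 - (1 + t) * p2)
     - ((M + \<beta> + 1) * (M + K) + (M + K) * K - K) * p0
     = (1 + t) * ((1 - t\<^sup>2) * p3 + (\<beta> - (\<beta> + 4) * t) * p2 - (\<beta> + 2 - K) * p1)
       + (1 - M - K) * ((1 - t\<^sup>2) * p2 + (\<beta> - (\<beta> + 2) * t) * p1 + K * p0)"
    by (simp add: algebra_simps power2_eq_square)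
  ultimately show ?thesis
    unfolding q0 q1 q2 e1 e2 p0_def[symmetric] by simp
qed

lemma degree_jacobi_type_le: "\<beta> \<ge> 0 \<Longrightarrow> degree (jacobi_type \<beta> M k) \<le> k"
proof (intro degree_le allI impI)
  fix i assume "\<beta> \<ge> 0" "k < i"
  then show "coeff (jacobi_type \<beta> M k) i = 0"
    by (auto simp: jacobi_type_altdef coeff_pderiv coeff_pCons degree_jacobi coeff_eq_0 split: nat.splits)
qed

text \<open>(1 + t) d/dt multiplies the leading coefficient by k, which leaves the factor M + k(k +
  \<beta>) > 0.\<close>

lemma lead_coeff_jacobi_type:
  assumes "\<beta> \<ge> 0" "M > 0"
  shows "coeff (jacobi_type \<beta> M k) k \<noteq> 0"
proof -
  have "coeff (jacobi 0 \<beta> k) k \<noteq> 0"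
    using degree_jacobi[OF assms(1), of k] poly_jacobi_1[OF assms(1), of k]
    by (metis leading_coeff_0_iff poly_0 zero_neq_one)
  moreover have "coeff (jacobi_type \<beta> M k) k = (M + jac_eig \<beta> k - real k) * coeff (jacobi 0 \<beta> k) k"
    using assms(1)
    by (cases k) (auto simp: jacobi_type_altdef coeff_pderiv coeff_pCons degree_jacobi coeff_eq_0 algebra_simps)
  moreover have "M + jac_eig \<beta> k - real k > 0"
    using assms by (simp add: jac_eig_def algebra_simps add_pos_nonneg)
  ultimately show ?thesis by simp
qed

text \<open>At t = 1 the Jacobi equation loses its second-order term and reads 2 p'(1) =
  \<open>jac_eig \<beta> k\<close>, so everything except \<open>M\<close> cancels.\<close>

lemma poly_jacobi_type_1: "\<beta> \<ge> 0 \<Longrightarrow> poly (jacobi_type \<beta> M k) 1 = M"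
  using jacobi_equation[of \<beta> 1 k] by (simp add: jacobi_type_altdef poly_jacobi_1)

text \<open>The product is a multiple of p (1 + t)^j minus an exact derivative. Orthogonality kills
  the first, and the second leaves its boundary value at 1; in particular the result does not
  involve \<open>M\<close>.\<close>

lemma jac_int_jacobi_type:
  assumes "\<beta> \<ge> 0" "j < k"
  shows "jac_int \<beta> (jacobi_type \<beta> M k * [:1, 1:] ^ j) = - (2 powr (\<beta> + 1) * 2 ^ j)"
proof -
  define p where "p = jacobi 0 \<beta> k"
  have 0: "jac_int \<beta> (p * [:1, 1:] ^ j) = 0"
    unfolding p_def using assms jac_op_jacobi by (intro jac_eigenpoly_orthogonal)
  have d: "poly (pderiv ([:1, 1:] ^ j)) t * (1 + t) = real j * (1 + t) ^ j" for t
    unfolding pderiv_linear_power by (cases j) (simp_all add: poly_power algebra_simps)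
  have "smult (M + jac_eig \<beta> k + \<beta> + 1 + real j) (p * [:1, 1:] ^ j) = jacobi_type \<beta> M k * [:1, 1:] ^ j
     + (smult (\<beta> + 1) (p * [:1, 1:] ^ j) + [:1, 1:] * pderiv (p * [:1, 1:] ^ j))"
  proof (rule poly_ext)
    fix t
    show "poly (smult (M + jac_eig \<beta> k + \<beta> + 1 + real j) (p * [:1, 1:] ^ j)) t = poly (jacobi_type \<beta> M k * [:1, 1:] ^ j
     + (smult (\<beta> + 1) (p * [:1, 1:] ^ j) + [:1, 1:] * pderiv (p * [:1, 1:] ^ j))) t"
      using arg_cong[OF d[of t], of "\<lambda>z. poly p t * z"]
      unfolding jacobi_type_altdef p_def[symmetric] pderiv_mult by (simp add: poly_power algebra_simps)
  qed
  then have "0 = jac_int \<beta> (jacobi_type \<beta> M k * [:1, 1:] ^ j) + 2 powr (\<beta> + 1) * poly (p * [:1, 1:] ^ j) 1"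
    by (metis 0 assms(1) jac_int_add jac_int_by_parts jac_int_smult mult_zero_right)
  then show ?thesis
    using assms(1) by (simp add: p_def poly_jacobi_1 poly_power)
qed

lemma jac_int_power: "\<beta> \<ge> 0 \<Longrightarrow> (\<beta> + 1 + real j) * jac_int \<beta> ([:1, 1:] ^ j) = 2 powr (\<beta> + 1) * 2 ^ j"
proof -
  assume \<beta>: "\<beta> \<ge> 0"
  have "[:1, 1:] * pderiv ([:1, 1:] ^ j) = smult (real j) ([:1, 1:] ^ j)"
    unfolding pderiv_linear_power by (cases j) simp_all
  then show ?thesis
    using jac_int_by_parts[OF \<beta>, of "[:1, 1:] ^ j"]
    by (simp only: smult_add_left[symmetric] jac_int_smult) (simp add: poly_power)
qed

section \<open>Integrals over the ball and the sphere\<close>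

abbreviation ball_int :: "(real ^ 'd::finite \<Rightarrow> real) \<Rightarrow> real" where
  "ball_int f \<equiv> (LINT x:cball 0 1|lborel. f x)"

abbreviation sphere_int :: "(real ^ 'd::finite \<Rightarrow> real) \<Rightarrow> real" where
  "sphere_int f \<equiv> (LINT \<xi>:sphere 0 1|surface_measure. f \<xi>)"

lemma borel_measurable_polys:
  fixes f :: "real ^ 'd::finite \<Rightarrow> real"
  shows "f \<in> polys_of A \<Longrightarrow> f \<in> borel_measurable borel"
  by (intro borel_measurable_continuous_onI continuous_on_polys)

lemma polys_bounded_on_ball:
  fixes f :: "real ^ 'd::finite \<Rightarrow> real"
  assumes "f \<in> polys_of A"
  obtains C where "\<And>x. norm x \<le> 1 \<Longrightarrow> \<bar>f x\<bar> \<le> C"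
proof -
  have "bounded (f ` cball 0 1)"
    by (intro compact_imp_bounded compact_continuous_image continuous_on_polys[OF assms] compact_cball)
  then obtain C where C: "\<forall>y\<in>f ` cball 0 1. norm y \<le> C"
    unfolding bounded_iff by blast
  show ?thesis
    by (rule that[of C]) (use C in auto)
qed

lemma polys_integrable_ball:
  fixes f :: "real ^ 'd::finite \<Rightarrow> real"
  assumes "f \<in> polys_of A" "S \<in> sets borel" "S \<subseteq> cball 0 1"
  shows "set_integrable lborel S f"
proof -
  obtain C where "\<And>x. norm x \<le> 1 \<Longrightarrow> \<bar>f x\<bar> \<le> C"
    using polys_bounded_on_ball[OF assms(1)] by blast
  then show ?thesis
    using assms by (intro set_integrable_bounded[of _ _ C] borel_measurable_polys[OF assms(1)])
      (auto intro: bounded_subset[OF bounded_cball])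
qed

lemma polys_integrable_sphere:
  fixes f :: "real ^ 'd::finite \<Rightarrow> real"
  assumes "f \<in> polys_of A"
  shows "set_integrable surface_measure (sphere 0 1) f"
proof -
  obtain C where C: "\<And>x. norm x \<le> 1 \<Longrightarrow> \<bar>f x\<bar> \<le> C"
    using polys_bounded_on_ball[OF assms(1)] by blast
  have s: "sets (surface_measure :: (real ^ 'd) measure) = sets borel"
    by (simp add: surface_measure_def)
  have "integrable surface_measure (\<lambda>x :: real ^ 'd. indicator (sphere 0 1) x *\<^sub>R C)"
    using emeasure_surface_measure_sphere[where 'a = "real ^ 'd"]
    by (intro integrable_scaleR_left integrable_real_indicator) (auto simp: s)
  then show ?thesis
    unfolding set_integrable_def
  proof (rule Bochner_Integration.integrable_bound)
    have "(\<lambda>x. indicator (sphere 0 1) x *\<^sub>R f x) \<in> borel_measurable borel"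
      by (intro borel_measurable_scaleR borel_measurable_indicator borel_measurable_polys[OF assms]) simp
    then show "(\<lambda>x. indicator (sphere 0 1) x *\<^sub>R f x) \<in> borel_measurable surface_measure"
      by (simp cong: measurable_cong_sets add: s)
    show "AE x in surface_measure. norm (indicator (sphere 0 1) x *\<^sub>R f x) \<le> norm (indicator (sphere 0 1) x *\<^sub>R C)"
      using C by (intro AE_I2) (auto simp: indicator_def intro: order.trans[OF _ abs_ge_self])
  qed
qed

lemma sphere_int_add:
  "f \<in> polys_of A \<Longrightarrow> g \<in> polys_of B \<Longrightarrow> sphere_int (\<lambda>x. f x + g x) = sphere_int f + sphere_int g"
  by (intro set_integral_add polys_integrable_sphere)

lemma sphere_int_sum:
  "(\<And>i. i \<in> I \<Longrightarrow> f i \<in> polys_of A) \<Longrightarrow> sphere_int (\<lambda>x. \<Sum>i\<in>I. f i x) = (\<Sum>i\<in>I. sphere_int (f i))"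
proof (induction I rule: infinite_finite_induct)
  case (insert i I)
  then show ?case using sphere_int_add[OF _ polys_of_sum[of I f A], of "f i" A] by simp
qed simp_all

lemma ball_int_add:
  "f \<in> polys_of A \<Longrightarrow> g \<in> polys_of B \<Longrightarrow> ball_int (\<lambda>x. f x + g x) = ball_int f + ball_int g"
  by (intro set_integral_add polys_integrable_ball) auto

lemma ball_int_sum:
  "(\<And>i. i \<in> I \<Longrightarrow> f i \<in> polys_of A) \<Longrightarrow> ball_int (\<lambda>x. \<Sum>i\<in>I. f i x) = (\<Sum>i\<in>I. ball_int (f i))"
proof (induction I rule: infinite_finite_induct)
  case (insert i I)
  then show ?case using ball_int_add[OF _ polys_of_sum[of I f A], of "f i" A] by simp
qed simp_all

lemma sphere_int_cong: "(\<And>x. norm x = 1 \<Longrightarrow> f x = g x) \<Longrightarrow> sphere_int f = sphere_int g"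
  unfolding set_lebesgue_integral_def by (intro Bochner_Integration.integral_cong) (auto simp: indicator_def)

section \<open>Sphere integrals as ball integrals of homogeneous functions\<close>

text \<open>Change of variables in the definition of \<open>surface_measure\<close>. The origin,
  which \<open>x /\<^sub>R norm x\<close> sends to 0 instead of the sphere, is discarded as a null
  set.\<close>

lemma sphere_int_eq_cone:
  fixes f :: "real ^ 'd::finite \<Rightarrow> real"
  assumes [measurable]: "f \<in> borel_measurable borel"
  shows "sphere_int f = real CARD('d) * (LINT x:ball 0 1|lborel. f (x /\<^sub>R norm x))"
proof -
  let ?p = "\<lambda>x :: real ^ 'd. x /\<^sub>R norm x"
  have e: "of_nat DIM(real ^ 'd) * indicator (ball 0 1) x = ennreal (real CARD('d) * indicator (ball 0 1) x)" for x :: "real ^ 'd"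
    by (simp add: ennreal_of_nat_eq_real_of_nat indicator_def)
  have [measurable]: "?p \<in> borel_measurable borel" by measurable
  have m: "(\<lambda>x. indicator (sphere 0 1) x *\<^sub>R f x) \<in> borel_measurable borel"
    by (intro borel_measurable_scaleR borel_measurable_indicator assms) simp
  have m': "(\<lambda>x. indicator (sphere 0 1) (?p x) *\<^sub>R f (?p x)) \<in> borel_measurable borel"
    by (rule measurable_compose[OF _ m]) simp
  have mb: "(\<lambda>x :: real ^ 'd. real CARD('d) * indicator (ball 0 1) x) \<in> borel_measurable borel"
    by (intro borel_measurable_times borel_measurable_const borel_measurable_indicator) simp
  have "sphere_int f = (LINT x|density lborel (\<lambda>x. ennreal (real CARD('d) * indicator (ball 0 1) x)).
      indicator (sphere 0 1) (?p x) *\<^sub>R f (?p x))"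
    unfolding set_lebesgue_integral_def surface_measure_def e
    using m by (subst integral_distr) simp_all
  also have "\<dots> = (LINT x|lborel. (real CARD('d) * indicator (ball 0 1) x) *\<^sub>R (indicator (sphere 0 1) (?p x) *\<^sub>R f (?p x)))"
    using m' mb by (subst integral_density) simp_all
  also have "\<dots> = (LINT x|lborel. real CARD('d) * (indicator (ball 0 1) x *\<^sub>R f (?p x)))"
  proof (intro integral_cong_AE)
    have "AE x in lborel. x \<noteq> (0 :: real ^ 'd)" by (rule AE_lborel_singleton)
    then show "AE x in lborel. (real CARD('d) * indicator (ball 0 1) x) *\<^sub>R (indicator (sphere 0 1) (?p x) *\<^sub>R f (?p x))
       = real CARD('d) * (indicator (ball 0 1) x *\<^sub>R f (?p x))"
      by eventually_elim (auto simp: indicator_def)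
    show "(\<lambda>x. (real CARD('d) * indicator (ball 0 1) x) *\<^sub>R (indicator (sphere 0 1) (?p x) *\<^sub>R f (?p x)))
        \<in> borel_measurable lborel"
      using borel_measurable_scaleR[OF mb m'] by simp
    have mf: "(\<lambda>x. f (?p x)) \<in> borel_measurable borel"
      by (rule measurable_compose[OF _ assms]) simp
    show "(\<lambda>x. real CARD('d) * (indicator (ball 0 1) x *\<^sub>R f (?p x))) \<in> borel_measurable lborel"
      using borel_measurable_scaleR[OF mb mf] by (simp add: mult.assoc)
  qed
  finally show ?thesis by (simp add: set_lebesgue_integral_def)
qed

lemma ball_integral_scale:
  fixes g :: "real ^ 'd::finite \<Rightarrow> real"
  assumes [measurable]: "g \<in> borel_measurable borel" and "c > 0" and g: "\<And>x. g (c *\<^sub>R x) = c ^ m * g x"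
  shows "(LINT x:ball 0 c|lborel. g x) = c ^ (CARD('d) + m) * (LINT x:ball 0 1|lborel. g x)"
proof -
  have eq: "(lborel :: (real ^ 'd) measure) = density (distr lborel borel (\<lambda>x. 0 + c *\<^sub>R x)) (\<lambda>_. ennreal (c ^ CARD('d)))"
    using lborel_affine[of c "0 :: real ^ 'd"] \<open>c > 0\<close> by simp
  have m: "(\<lambda>x. indicator (ball 0 c) x *\<^sub>R g x) \<in> borel_measurable borel"
    by (intro borel_measurable_scaleR borel_measurable_indicator assms) simp
  have "(LINT x:ball 0 c|lborel. g x) = (LINT x|distr lborel borel (\<lambda>x. 0 + c *\<^sub>R x). c ^ CARD('d) *\<^sub>R (indicator (ball 0 c) x *\<^sub>R g x))"
    unfolding set_lebesgue_integral_def using \<open>c > 0\<close> m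
    by (subst eq, subst integral_density) simp_all
  also have "\<dots> = (LINT x|lborel. c ^ CARD('d) *\<^sub>R (indicator (ball 0 c) (c *\<^sub>R x) *\<^sub>R g (c *\<^sub>R x)))"
    using m by (subst integral_distr) simp_all
  also have "\<dots> = (LINT x|lborel. c ^ (CARD('d) + m) * (indicator (ball 0 1) x *\<^sub>R g x))"
    using \<open>c > 0\<close> by (intro Bochner_Integration.integral_cong) (auto simp: indicator_def g power_add)
  finally show ?thesis by (simp add: set_lebesgue_integral_def)
qed

lemma ball_int_open: "ball_int f = (LINT x:ball (0 :: real ^ 'd::finite) 1|lborel. f x)"
  if "f \<in> polys_of A" for f
proof -
  have "negligible (sphere (0 :: real ^ 'd) 1)" by (rule negligible_sphere)
  then have "sphere (0 :: real ^ 'd) 1 \<in> null_sets lborel"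
    by (simp add: negligible_iff_null_sets null_sets_completion_iff)
  then have "AE x in lborel. x \<notin> sphere (0 :: real ^ 'd) 1" by (rule AE_not_in)
  moreover have [measurable]: "f \<in> borel_measurable borel"
    by (rule borel_measurable_polys[OF that])
  ultimately show ?thesis
    unfolding set_lebesgue_integral_def
    by (intro integral_cong_AE) (measurable, auto elim!: eventually_mono simp: indicator_def)
qed

lemma geometric_diff: "1 - c ^ n = (1 - c) * (\<Sum>i<n. c ^ i)" for c :: real
  by (simp add: one_diff_power_eq)

text \<open>On the annulus between the radii \<open>c\<close> and \<open>1\<close> a homogeneous function differs from its
  \<open>0\<close>-homogeneous counterpart only by \<open>O(1 - c)\<close>, relative to the volume. Both annulus integrals are known by scaling;
  dividing by \<open>1 - c\<close> and letting \<open>c\<close> tend to \<open>1\<close> compares the two ball integrals.\<close>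

lemma homogeneous_ball_int:
  fixes H :: "real ^ 'd::finite \<Rightarrow> real"
  assumes "H \<in> polys_of {h}"
  shows "(real CARD('d) + real h) * ball_int H = sphere_int H"
proof -
  let ?d = "CARD('d)"
  define \<phi> where "\<phi> x = H (x /\<^sub>R norm x)" for x
  have [measurable]: "H \<in> borel_measurable borel" by (rule borel_measurable_polys[OF assms])
  have [measurable]: "\<phi> \<in> borel_measurable borel" unfolding \<phi>_def by measurable
  obtain C where C: "\<And>x. norm x \<le> 1 \<Longrightarrow> \<bar>H x\<bar> \<le> C"
    using polys_bounded_on_ball[OF assms] by blast
  have C\<phi>: "\<bar>\<phi> x\<bar> \<le> C" for x
    unfolding \<phi>_def by (intro C) (cases "x = 0"; simp)
  have H: "H x = norm x ^ h * \<phi> x" if "x \<noteq> 0" for x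
    using homogeneous_scaleR[OF assms, of "norm x" "x /\<^sub>R norm x"] that by (simp add: \<phi>_def)
  \<comment> \<open>The factor \<open>c ^ 0\<close> presents \<open>\<phi>\<close> as homogeneous of
    degree 0, so that one annulus formula serves both \<open>H\<close> and
    \<open>\<phi>\<close>.\<close>
  have \<phi>c: "\<phi> (c *\<^sub>R x) = c ^ 0 * \<phi> x" if "c > 0" for c x
    using that by (simp add: \<phi>_def field_simps)
  have int\<phi>: "set_integrable lborel S \<phi>" if "S \<in> sets borel" "bounded S" for S
    using that C\<phi> by (intro set_integrable_bounded[of _ _ C]) auto
  have intH: "set_integrable lborel S H" if "S \<in> sets borel" "S \<subseteq> cball 0 1" for S
    using that assms by (intro polys_integrable_ball)
  define A where "A = (LINT x:ball 0 1|lborel. H x)"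
  define B where "B = (LINT x:ball 0 1|lborel. \<phi> x)"
  define D where "D = (LINT x:ball 0 1|lborel. \<bar>\<phi> x\<bar>)"
  have ineq: "\<bar>(\<Sum>i<?d + h. c ^ i) * A - (\<Sum>i<?d. c ^ i) * B\<bar> \<le> (1 - c ^ h) * ((\<Sum>i<?d. c ^ i) * D)"
    if c: "0 < c" "c < 1" for c
  proof -
    let ?S = "ball 0 1 - ball 0 c :: (real ^ 'd) set"
    have U: "ball 0 1 = ball 0 c \<union> ?S" using c by auto
    have b: "bounded ?S" "bounded (ball 0 c :: (real ^ 'd) set)"
      by (auto intro: bounded_subset[OF bounded_ball])
    have annulus: "(LINT x:?S|lborel. g x) = (1 - c ^ (?d + m)) * (LINT x:ball 0 1|lborel. g x)"
      if "g \<in> borel_measurable borel" "\<And>x. g (c *\<^sub>R x) = c ^ m * g x"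
         "set_integrable lborel ?S g" "set_integrable lborel (ball 0 c) g" for g :: "real ^ 'd \<Rightarrow> real" and m
    proof -
      have "(LINT x:ball 0 1|lborel. g x) = (LINT x:ball 0 c|lborel. g x) + (LINT x:?S|lborel. g x)"
        by (subst U, rule set_integral_Un) (use that in auto)
      then have "(LINT x:?S|lborel. g x) = (LINT x:ball 0 1|lborel. g x) - (LINT x:ball 0 c|lborel. g x)"
        by linarith
      then show ?thesis
        unfolding ball_integral_scale[OF that(1) c(1) that(2)] by (simp only: left_diff_distrib mult_1)
    qed
    have sub: "?S \<subseteq> cball 0 1" "ball 0 c \<subseteq> (cball 0 1 :: (real ^ 'd) set)" using c by auto
    have m: "?S \<in> sets borel" "(ball 0 c :: (real ^ 'd) set) \<in> sets borel" by auto
    note iS = intH[OF m(1) sub(1)] int\<phi>[OF m(1) b(1)] and i = intH[OF m(2) sub(2)] int\<phi>[OF m(2) b(2)]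
    note iS = iS set_integrable_abs[OF iS(2)] and i = i set_integrable_abs[OF i(2)]
    have "(LINT x:?S|lborel. H x - \<phi> x) = (1 - c ^ (?d + h)) * A - (1 - c ^ ?d) * B"
      using annulus[OF _ homogeneous_scaleR[OF assms] iS(1) i(1)] annulus[OF _ \<phi>c[OF c(1)] iS(2) i(2)]
      by (simp add: set_integral_diff[OF iS(1,2)] A_def B_def)
    moreover have "\<bar>LINT x:?S|lborel. H x - \<phi> x\<bar> \<le> (LINT x:?S|lborel. \<bar>H x - \<phi> x\<bar>)"
      using set_integral_norm_bound[OF set_integral_diff(1)[OF iS(1,2)]] by simp
    moreover have "(LINT x:?S|lborel. \<bar>H x - \<phi> x\<bar>) \<le> (LINT x:?S|lborel. (1 - c ^ h) * \<bar>\<phi> x\<bar>)"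
    proof (rule set_integral_mono)
      show "set_integrable lborel ?S (\<lambda>x. \<bar>H x - \<phi> x\<bar>)"
        by (intro set_integrable_abs set_integral_diff iS)
      show "set_integrable lborel ?S (\<lambda>x. (1 - c ^ h) * \<bar>\<phi> x\<bar>)"
        using iS(3) by simp
      fix x :: "real ^ 'd" assume x: "x \<in> ?S"
      then have "c ^ h \<le> norm x ^ h" "norm x ^ h \<le> 1" and "x \<noteq> 0"
        using c by (auto intro!: power_mono power_le_one)
      moreover have "H x - \<phi> x = - ((1 - norm x ^ h) * \<phi> x)"
        using H[OF \<open>x \<noteq> 0\<close>] by (simp add: algebra_simps)
      ultimately show "\<bar>H x - \<phi> x\<bar> \<le> (1 - c ^ h) * \<bar>\<phi> x\<bar>"
        by (simp add: abs_mult mult_right_mono)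
    qed
    moreover have "(LINT x:?S|lborel. (1 - c ^ h) * \<bar>\<phi> x\<bar>) = (1 - c ^ h) * ((1 - c ^ ?d) * D)"
      using annulus[of "\<lambda>x. \<bar>\<phi> x\<bar>" 0] iS(3) i(3) \<phi>c[OF c(1)] by (simp add: D_def)
    ultimately have "\<bar>(1 - c ^ (?d + h)) * A - (1 - c ^ ?d) * B\<bar> \<le> (1 - c ^ h) * ((1 - c ^ ?d) * D)"
      by linarith
    also have "(1 - c ^ (?d + h)) * A - (1 - c ^ ?d) * B = (1 - c) * ((\<Sum>i<?d + h. c ^ i) * A - (\<Sum>i<?d. c ^ i) * B)"
      unfolding geometric_diff by (simp add: algebra_simps)
    also have "(1 - c ^ h) * ((1 - c ^ ?d) * D) = (1 - c) * ((1 - c ^ h) * ((\<Sum>i<?d. c ^ i) * D))"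
      unfolding geometric_diff[of c ?d] by (simp add: algebra_simps)
    finally show ?thesis using c by (simp add: abs_mult)
  qed
  have "((\<lambda>c. \<bar>(\<Sum>i<?d + h. c ^ i) * A - (\<Sum>i<?d. c ^ i) * B\<bar>) \<longlongrightarrow> \<bar>(\<Sum>i<?d + h. 1 ^ i) * A - (\<Sum>i<?d. 1 ^ i) * B\<bar>) (at_left (1::real))"
    by (intro tendsto_intros)
  moreover have "((\<lambda>c. (1 - c ^ h) * ((\<Sum>i<?d. c ^ i) * D)) \<longlongrightarrow> (1 - 1 ^ h) * ((\<Sum>i<?d. 1 ^ i) * D)) (at_left (1::real))"
    by (intro tendsto_intros)
  moreover have "eventually (\<lambda>c. \<bar>(\<Sum>i<?d + h. c ^ i) * A - (\<Sum>i<?d. c ^ i) * B\<bar>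
       \<le> (1 - c ^ h) * ((\<Sum>i<?d. c ^ i) * D)) (at_left (1::real))"
    by (rule eventually_mono[OF eventually_at_left_real[of 0 1]]) (use ineq in auto)
  ultimately have "\<bar>(\<Sum>i<?d + h. 1 ^ i) * A - (\<Sum>i<?d. 1 ^ i) * B\<bar> \<le> (1 - 1 ^ h) * ((\<Sum>i<?d. 1 ^ i) * D)"
    by (intro tendsto_le[of "at_left (1::real)"]) auto
  then have "(real ?d + real h) * A = real ?d * B" by simp
  then show ?thesis
    using sphere_int_eq_cone[of H] ball_int_open[OF assms] by (simp add: A_def B_def \<phi>_def)
qed

text \<open>Powers of |x|^2 raise the degree but equal 1 on the sphere, so all these ball integrals
  are the same sphere integral over different denominators. This replaces radial integration by
  arithmetic.\<close>

lemma ball_int_norm_power_mult: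
  fixes H :: "real ^ 'd::finite \<Rightarrow> real"
  assumes "H \<in> polys_of {h}"
  shows "(real CARD('d) + real h + 2 * real j) * ball_int (\<lambda>x. ((norm x)\<^sup>2) ^ j * H x) = sphere_int H"
proof -
  have "(\<lambda>x. ((norm x)\<^sup>2) ^ j * H x) \<in> polys_of {h + 2 * j}"
    using assms by (intro polys_of_mult[OF polys_of_norm_sq_power[of _ "{2 * j}"]]) auto
  from homogeneous_ball_int[OF this]
  have "(real CARD('d) + real h + 2 * real j) * ball_int (\<lambda>x. ((norm x)\<^sup>2) ^ j * H x) = sphere_int (\<lambda>x. ((norm x)\<^sup>2) ^ j * H x)"
    by (simp add: algebra_simps)
  also have "\<dots> = sphere_int H" by (rule sphere_int_cong) simp
  finally show ?thesis .
qed

section \<open>Integration by parts and orthogonality of harmonics\<close>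

text \<open>Squaring removes the kink of the positive part, as the difference quotient at 0 is
  \<open>max 0 h\<close>; this is why the cutoff carries the exponent 2.\<close>

lemma has_real_derivative_pos_part_sq:
  "((\<lambda>u::real. (max 0 u)\<^sup>2) has_real_derivative 2 * max 0 u) (at u)"
proof (cases "u = 0")
  case True
  have "(max 0 (0 + h))\<^sup>2 / h = max 0 h" for h :: real
    by (auto simp: max_def power2_eq_square)
  moreover have "((\<lambda>h::real. max 0 h) \<longlongrightarrow> max 0 0) (at 0)"
    by (intro tendsto_intros)
  ultimately show ?thesis
    using True by (simp add: DERIV_def)
next
  case False
  show ?thesis
  proof (cases "u > 0")
    case True
    have "((\<lambda>u::real. u\<^sup>2) has_real_derivative 2 * u) (at u)"
      by (auto intro!: derivative_eq_intros)
    then show ?thesis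
      using True by (simp add: max_def)
        (rule has_field_derivative_transform_within_open[of _ _ _ "{0<..}"], auto)
  next
    case False2: False
    have "((\<lambda>u::real. 0) has_real_derivative 0) (at u)" by simp
    then show ?thesis
      using False False2
      by (simp add: max_def) (rule has_field_derivative_transform_within_open[of _ _ _ "{..<0}"], auto)
  qed
qed

text \<open>Translation invariance makes \<open>\<integral> F (x + t e\<^sub>i) dx\<close> constant in \<open>t\<close>;
  with \<open>F = (1 - |x|\<^sup>2)\<^sub>+\<^sup>2 f\<close>, which is continuously differentiable, its derivative at \<open>0\<close> is the
  difference of the two sides.\<close>

lemma ball_int_partial_by_parts:
  fixes f :: "real ^ 'd::finite \<Rightarrow> real"
  assumes "f \<in> polys_of A"
  shows "ball_int (\<lambda>x. (1 - (norm x)\<^sup>2)\<^sup>2 * partial i f x) = ball_int (\<lambda>x. 4 * (1 - (norm x)\<^sup>2) * (x $ i * f x))"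
proof -
  define e where "e = (axis i 1 :: real ^ 'd)"
  define w where "w x = max 0 (1 - (norm x)\<^sup>2)" for x :: "real ^ 'd"
  define F where "F x = (w x)\<^sup>2 * f x" for x
  define G where "G x = (w x)\<^sup>2 * partial i f x - 4 * w x * (x $ i * f x)" for x
  have outside: "w x = 0" if "norm x > 1" for x
    using that power_mono[of 1 "norm x" 2] by (simp add: w_def)
  note cf = continuous_on_polys[OF assms] continuous_on_polys[OF partial_polys_UNIV[OF assms]]
  have contF: "continuous_on S F" and contG: "continuous_on S G" for S
    unfolding F_def G_def w_def by (auto intro!: continuous_intros cf)
  have D0: "((\<lambda>t. F (x + t *\<^sub>R e)) has_real_derivative G x) (at 0)" for x
  proof -
    have "(norm (x + t *\<^sub>R e))\<^sup>2 = (norm x)\<^sup>2 + 2 * x $ i * t + t\<^sup>2" for t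
      unfolding power2_norm_eq_inner e_def
      by (simp add: inner_add_left inner_add_right inner_axis inner_axis' inner_axis_axis power2_eq_square algebra_simps)
    then have "((\<lambda>t. 1 - (norm (x + t *\<^sub>R e))\<^sup>2) has_real_derivative - 2 * x $ i) (at 0)"
      by (auto intro!: derivative_eq_intros)
    from DERIV_chain2[where g = "\<lambda>t. 1 - (norm (x + t *\<^sub>R e))\<^sup>2", OF has_real_derivative_pos_part_sq this]
    have "((\<lambda>t. (w (x + t *\<^sub>R e))\<^sup>2) has_real_derivative 2 * w x * (- 2 * x $ i)) (at 0)"
      by (simp add: w_def)
    from DERIV_mult[OF this polys_has_partial[OF assms, of x i, folded e_def]]
    show ?thesis by (simp add: F_def G_def algebra_simps)
  qed
  have D: "((\<lambda>t. F (x + t *\<^sub>R e)) has_real_derivative G (x + t *\<^sub>R e)) (at t)" for x t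
    using D0[of "x + t *\<^sub>R e"] DERIV_shift[of "\<lambda>t. F (x + t *\<^sub>R e)" _ 0 t]
    by (simp add: algebra_simps)
  \<comment> \<open>A cube of half-width 2 still contains the unit ball after a shift by at most 1
    along \<open>e\<close>.\<close>
  define a :: "real ^ 'd" where "a = (\<chi> i. -2)"
  define b :: "real ^ 'd" where "b = (\<chi> i. 2)"
  have sub: "cball 0 1 \<subseteq> cbox (a + t *\<^sub>R e) (b + t *\<^sub>R e)" if "\<bar>t\<bar> \<le> 1" for t
  proof
    fix x :: "real ^ 'd" assume x: "x \<in> cball 0 1"
    have "\<bar>x $ j\<bar> \<le> 1" for j
      using component_le_norm_cart[of x j] x by auto
    moreover have "\<bar>t * e $ j\<bar> \<le> 1" for j
      using that by (auto simp: e_def axis_def)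
    ultimately have "- 2 + t * e $ j \<le> x $ j \<and> x $ j \<le> 2 + t * e $ j" for j
      by (smt (verit))
    then show "x \<in> cbox (a + t *\<^sub>R e) (b + t *\<^sub>R e)"
      by (simp add: mem_box_cart a_def b_def)
  qed
  have restrict: "integral S g = integral (cball 0 1) g"
    if "cball 0 1 \<subseteq> S" "\<And>x. norm x > 1 \<Longrightarrow> g x = 0" for S and g :: "real ^ 'd \<Rightarrow> real"
  proof -
    have 1: "(\<lambda>x. if x \<in> S then g x else 0) = g" using that by (force simp: subset_iff)
    have 2: "(\<lambda>x. if x \<in> cball 0 1 then g x else 0) = g" using that by force
    show ?thesis
      using Henstock_Kurzweil_Integration.integral_restrict_UNIV[of S g]
        Henstock_Kurzweil_Integration.integral_restrict_UNIV[of "cball 0 1" g]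
      unfolding 1 2 by simp
  qed
  have const: "integral (cbox a b) (\<lambda>x. F (x + t *\<^sub>R e)) = integral (cball 0 1) F" if "t \<in> {-1..1}" for t
  proof -
    have "integral (cbox a b) (\<lambda>x. F (x + t *\<^sub>R e)) = integral (cbox (a + t *\<^sub>R e) (b + t *\<^sub>R e)) F"
      using integral_shift_cbox_plus[of a b F "t *\<^sub>R e"] by (simp add: o_def add.commute)
    also have "\<dots> = integral (cball 0 1) F"
      using that by (intro restrict sub) (auto simp: F_def outside)
    finally show ?thesis .
  qed
  have "((\<lambda>t. integral (cbox a b) (\<lambda>x. F (x + t *\<^sub>R e))) has_field_derivative
      integral (cbox a b) (\<lambda>x. G (x + 0 *\<^sub>R e))) (at 0 within {-1..1})"
  proof (rule leibniz_rule_field_derivative)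
    show "((\<lambda>t. F (x + t *\<^sub>R e)) has_real_derivative G (x + t *\<^sub>R e)) (at t within {-1..1})" for x t
      using D by (rule has_field_derivative_at_within)
    show "(\<lambda>x. F (x + t *\<^sub>R e)) integrable_on cbox a b" for t
      by (intro integrable_continuous continuous_on_compose2[OF contF[of UNIV]] continuous_intros) auto
    show "continuous_on ({-1..1} \<times> cbox a b) (\<lambda>(t, x). G (x + t *\<^sub>R e))"
      unfolding case_prod_beta
      by (intro continuous_on_compose2[OF contG[of UNIV]] continuous_intros) auto
  qed auto
  moreover have "((\<lambda>t. integral (cbox a b) (\<lambda>x. F (x + t *\<^sub>R e))) has_field_derivative 0) (at 0 within {-1..1})"
    by (rule has_field_derivative_transform_within[of "\<lambda>t. integral (cball 0 1) F" _ _ _ 1]) (auto simp: const)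
  moreover have "at (0::real) within {-1..1} \<noteq> bot"
    by (simp add: trivial_limit_within islimpt_Icc)
  ultimately have "integral (cbox a b) (\<lambda>x. G (x + 0 *\<^sub>R e)) = 0"
    using has_field_derivative_unique by blast
  then have "integral (cbox a b) G = 0" by simp
  moreover have "integral (cbox a b) G = integral (cball 0 1) G"
    using sub[of 0] by (intro restrict) (simp_all add: G_def outside)
  ultimately have "integral (cball 0 1) G = 0" by simp
  moreover have "integral (cball 0 1) G = integral (cball 0 1)
      (\<lambda>x. (1 - (norm x)\<^sup>2)\<^sup>2 * partial i f x - 4 * (1 - (norm x)\<^sup>2) * (x $ i * f x))"
    by (rule Henstock_Kurzweil_Integration.integral_cong) (auto simp: G_def w_def max_def abs_square_le_1 power2_le_iff_abs_le power_le_one)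
  moreover have "set_integrable lborel (cball 0 1) (\<lambda>x. (1 - (norm x)\<^sup>2)\<^sup>2 * partial i f x)"
      "set_integrable lborel (cball 0 1) (\<lambda>x. 4 * (1 - (norm x)\<^sup>2) * (x $ i * f x))"
    unfolding set_integrable_def
    by (intro borel_integrable_compact continuous_intros cf compact_cball)+
  ultimately show ?thesis
    using set_integral_diff[of lborel "cball 0 1" "\<lambda>x. (1 - (norm x)\<^sup>2)\<^sup>2 * partial i f x" "\<lambda>x. 4 * (1 - (norm x)\<^sup>2) * (x $ i * f x)"]
      set_borel_integral_eq_integral(2)[of "cball 0 1" "\<lambda>x. (1 - (norm x)\<^sup>2)\<^sup>2 * partial i f x - 4 * (1 - (norm x)\<^sup>2) * (x $ i * f x)"]
    by simp
qed

text \<open>In substance the divergence theorem combined with homogeneity of degree h - 1. Here both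
  sides of the weighted identity are expanded in powers of |x|^2; each term is a sphere integral
  over a known denominator, and 1/a - 2/(a+2) + 1/(a+4) equals 1/a times 4/(a+2) - 4/(a+4).\<close>

lemma sphere_int_partial:
  fixes f :: "real ^ 'd::finite \<Rightarrow> real"
  assumes f: "f \<in> polys_of {h}"
  shows "sphere_int (partial i f) = (real CARD('d) + real h - 1) * sphere_int (\<lambda>x. x $ i * f x)"
proof -
  define G where "G = partial i f"
  define K where "K = (\<lambda>x. x $ i * f x)"
  define a where "a = real CARD('d) + real h - 1"
  have K: "K \<in> polys_of {h + 1}"
    unfolding K_def by (intro polys_of_mult[OF polys_of_component[of "{1}"] f]) auto
  have Kj: "(a + 2 + 2 * real j) * ball_int (\<lambda>x. ((norm x)\<^sup>2) ^ j * K x) = sphere_int K" for j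
    using ball_int_norm_power_mult[OF K, of j] by (simp add: a_def algebra_simps)
  have Gj: "(a + 2 * real j) * ball_int (\<lambda>x. ((norm x)\<^sup>2) ^ j * G x) = sphere_int G" for j
  \<comment> \<open>For \<open>h = 0\<close> the degree h - 1 has no meaning, but then
    \<open>G\<close> is zero.\<close>
  proof (cases h)
    case 0
    then have "G \<in> polys_of {}" unfolding G_def using f by (intro partial_polys[OF f]) auto
    then have "G = (\<lambda>x. 0)" by (simp add: polys_of_def zero_fun_def)
    then show ?thesis by simp
  next
    case (Suc h')
    have "G \<in> polys_of {h'}" unfolding G_def by (intro partial_polys[OF f]) (use Suc in auto)
    from ball_int_norm_power_mult[OF this, of j] show ?thesis by (simp add: a_def Suc algebra_simps)
  qed
  have G': "(\<lambda>x. ((norm x)\<^sup>2) ^ j * G x) \<in> polys_of UNIV" and K': "(\<lambda>x. ((norm x)\<^sup>2) ^ j * K x) \<in> polys_of UNIV" for j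
    using partial_polys_UNIV[OF f] polys_of_UNIV[OF K] unfolding G_def
    by (auto intro!: polys_of_UNIV_mult polys_of_norm_sq_power)
  define g where "g j = ball_int (\<lambda>x. ((norm x)\<^sup>2) ^ j * G x)" for j
  define k where "k j = ball_int (\<lambda>x. ((norm x)\<^sup>2) ^ j * K x)" for j
  have "ball_int (\<lambda>x. (1 - (norm x)\<^sup>2)\<^sup>2 * G x)
      = ball_int (\<lambda>x. (((norm x)\<^sup>2) ^ 0 * G x + (-2) * (((norm x)\<^sup>2) ^ 1 * G x)) + ((norm x)\<^sup>2) ^ 2 * G x)"
    by (intro arg_cong[where f = ball_int] ext) (simp add: algebra_simps power2_eq_square)
  also have "\<dots> = g 0 - 2 * g 1 + g 2"
    unfolding ball_int_add[OF polys_of_add[OF G' polys_of_cmult[OF G']] G']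
      ball_int_add[OF G' polys_of_cmult[OF G']] set_integral_mult_right g_def by simp
  finally have g: "ball_int (\<lambda>x. (1 - (norm x)\<^sup>2)\<^sup>2 * G x) = g 0 - 2 * g 1 + g 2" .
  have "ball_int (\<lambda>x. 4 * (1 - (norm x)\<^sup>2) * K x)
      = ball_int (\<lambda>x. 4 * (((norm x)\<^sup>2) ^ 0 * K x) + (-4) * (((norm x)\<^sup>2) ^ 1 * K x))"
    by (intro arg_cong[where f = ball_int] ext) (simp add: algebra_simps)
  also have "\<dots> = 4 * k 0 - 4 * k 1"
    unfolding ball_int_add[OF polys_of_cmult[OF K'] polys_of_cmult[OF K']] set_integral_mult_right k_def by simp
  finally have k: "ball_int (\<lambda>x. 4 * (1 - (norm x)\<^sup>2) * K x) = 4 * k 0 - 4 * k 1" .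
  have eq: "g 0 - 2 * g 1 + g 2 = 4 * k 0 - 4 * k 1"
    using ball_int_partial_by_parts[OF f, of i] g k by (simp add: G_def K_def)
  define IG where "IG = sphere_int G"
  define IK where "IK = sphere_int K"
  have "real CARD('d) \<ge> 1" by (simp add: Suc_leI)
  then have a: "a \<ge> 0" unfolding a_def by linarith
  have gs: "a * g 0 = IG" "(a + 2) * g 1 = IG" "(a + 4) * g 2 = IG"
    using Gj[of 0] Gj[of 1] Gj[of 2] by (simp_all add: g_def IG_def)
  have ks: "(a + 2) * k 0 = IK" "(a + 4) * k 1 = IK"
    using Kj[of 0] Kj[of 1] by (simp_all add: k_def IK_def add.commute)
  \<comment> \<open>Multiplying out the denominators instead of dividing also covers
    \<open>a = 0\<close>.\<close>
  have "a * ((a + 2) * (a + 4)) * (g 0 - 2 * g 1 + g 2) = (a + 2) * (a + 4) * (a * g 0) - 2 * a * (a + 4) * ((a + 2) * g 1)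
      + a * (a + 2) * ((a + 4) * g 2)"
    by (simp add: algebra_simps)
  also have "\<dots> = 8 * IG" unfolding gs by (simp add: algebra_simps)
  finally have 1: "a * ((a + 2) * (a + 4)) * (g 0 - 2 * g 1 + g 2) = 8 * IG" .
  have "a * ((a + 2) * (a + 4)) * (4 * k 0 - 4 * k 1) = 4 * a * (a + 4) * ((a + 2) * k 0) - 4 * a * (a + 2) * ((a + 4) * k 1)"
    by (simp add: algebra_simps)
  also have "\<dots> = 8 * (a * IK)" unfolding ks by (simp add: algebra_simps)
  finally have "IG = a * IK" using 1 unfolding eq by linarith
  then show ?thesis by (simp add: IG_def IK_def G_def K_def a_def)
qed

text \<open>The previous rule is applied to \<open>Y\<close> times \<open>partial i Z\<close>, of
  degree m + l - 1, and summed over i. The Laplacian of \<open>Z\<close> drops out on the left, and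
  Euler's identity for \<open>Z\<close> gives the factor l on the right.\<close>

lemma sphere_int_harmonic_euler:
  fixes Y Z :: "real ^ 'd::finite \<Rightarrow> real"
  assumes Y: "Y \<in> harmonic_polys m" and Z: "Z \<in> harmonic_polys l"
  shows "sphere_int (\<lambda>x. \<Sum>i\<in>UNIV. partial i Y x * partial i Z x)
    = (real CARD('d) + real m + real l - 2) * real l * sphere_int (\<lambda>x. Y x * Z x)"
proof (cases l)
  case 0
  have "partial i Z \<in> polys_of {}" for i
    by (intro partial_polys[OF harmonic_polysD(1)[OF Z]]) (use 0 in auto)
  then have "partial i Z = (\<lambda>x. 0)" for i by (simp add: polys_of_def zero_fun_def)
  then show ?thesis by (simp add: 0)
next
  case (Suc l')
  note Yp = harmonic_polysD(1)[OF Y] and Zp = harmonic_polysD(1)[OF Z]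
  have dZ: "partial i Z \<in> polys_of {l'}" for i
    by (intro partial_polys[OF Zp]) (use Suc in auto)
  have f: "(\<lambda>x. Y x * partial i Z x) \<in> polys_of {m + l'}" for i
    by (intro polys_of_mult[OF Yp dZ]) auto
  have 1: "(\<lambda>x. partial i Y x * partial i Z x) \<in> polys_of UNIV" "(\<lambda>x. Y x * partial i (partial i Z) x) \<in> polys_of UNIV"
    "(\<lambda>x. x $ i * (Y x * partial i Z x)) \<in> polys_of UNIV" for i
    by (intro polys_of_UNIV_mult partial_polys_UNIV[OF partial_polys_UNIV[OF Zp]] partial_polys_UNIV[OF Yp]
        partial_polys_UNIV[OF Zp] polys_of_UNIV[OF Yp] polys_of_component; simp)+
  have eq: "sphere_int (\<lambda>x. partial i Y x * partial i Z x + Y x * partial i (partial i Z) x)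
      = (real CARD('d) + real m + real l' - 1) * sphere_int (\<lambda>x. x $ i * (Y x * partial i Z x))" for i
    using sphere_int_partial[OF f, of i i] partial_mult[OF Yp dZ, of i i, abs_def] by (simp add: add.assoc)
  have "sphere_int (\<lambda>x. \<Sum>i\<in>UNIV. partial i Y x * partial i Z x)
     = sphere_int (\<lambda>x. \<Sum>i\<in>UNIV. partial i Y x * partial i Z x + Y x * partial i (partial i Z) x)"
    using harmonic_polysD(2)[OF Z]
    by (simp add: sum.distrib laplacian_def sum_distrib_left[symmetric])
  also have "\<dots> = (\<Sum>i\<in>UNIV. (real CARD('d) + real m + real l' - 1) * sphere_int (\<lambda>x. x $ i * (Y x * partial i Z x)))"
    by (subst sphere_int_sum[OF polys_of_add[OF 1(1,2)]]) (simp add: eq)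
  also have "\<dots> = (real CARD('d) + real m + real l' - 1) * sphere_int (\<lambda>x. \<Sum>i\<in>UNIV. x $ i * (Y x * partial i Z x))"
    by (subst sphere_int_sum[OF 1(3)]) (simp add: sum_distrib_left)
  also have "(\<lambda>x. \<Sum>i\<in>UNIV. x $ i * (Y x * partial i Z x)) = (\<lambda>x. real l * (Y x * Z x))"
    using euler_homogeneous[OF Zp] by (auto simp: euler_op_def mult.left_commute sum_distrib_left[symmetric])
  finally show ?thesis
    unfolding set_integral_mult_right using Suc by (simp add: mult.assoc)
qed

text \<open>Green's identity on the sphere in disguise: both sides of the previous lemma are symmetric except for the
  factor \<open>l\<close>.\<close>

lemma sphere_int_harmonic_orthogonal:
  fixes Y Z :: "real ^ 'd::finite \<Rightarrow> real"
  assumes "Y \<in> harmonic_polys m" "Z \<in> harmonic_polys l" "m \<noteq> l" and d: "CARD('d) \<ge> 2"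
  shows "sphere_int (\<lambda>x. Y x * Z x) = 0"
proof -
  define I where "I = sphere_int (\<lambda>x. Y x * Z x)"
  define a where "a = real CARD('d) + real m + real l - 2"
  have "a * real l * I = a * real m * I"
    using sphere_int_harmonic_euler[OF assms(1,2)] sphere_int_harmonic_euler[OF assms(2,1)]
    by (simp add: I_def a_def mult.commute algebra_simps)
  \<comment> \<open>From m \<noteq> l follows m + l \<ge> 1, and d \<ge> 2 does the rest.\<close>
  moreover have "a > 0" using assms(3) d by (auto simp: a_def)
  ultimately show ?thesis using assms(3) by (auto simp: I_def)
qed

section \<open>Orthogonal bases on the ball with mass on the sphere\<close>

lemma polys_on_line:
  fixes f :: "real ^ 'd::finite \<Rightarrow> real"
  assumes "f \<in> polys_of A"
  obtains p where "\<And>t. f (t *\<^sub>R x) = poly p t"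
proof -
  have "\<exists>p. \<forall>t. f (t *\<^sub>R x) = poly p t"
    using assms
  proof (induction rule: polys_of_induct)
    case zero
    show ?case by (intro exI[of _ 0]) simp
  next
    case (add c a g)
    then obtain p where p: "\<forall>t. g (t *\<^sub>R x) = poly p t" by blast
    show ?case
      by (intro exI[of _ "monom (c * monomial_fun a x) (\<Sum>i\<in>UNIV. a i) + p"])
         (simp add: p monomial_fun_scaleR poly_monom)
  qed
  then show ?thesis using that by blast
qed

text \<open>On the line through the origin and \<open>x\<close> the function is a univariate
  polynomial with infinitely many zeros near 0.\<close>

lemma polys_eq_0_on_ball:
  fixes f :: "real ^ 'd::finite \<Rightarrow> real"
  assumes "f \<in> polys_of A" "\<And>x. norm x < 1 \<Longrightarrow> f x = 0"
  shows "f x = 0"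
proof -
  obtain p where p: "\<And>t. f (t *\<^sub>R x) = poly p t"
    using polys_on_line[OF assms(1)] by blast
  have "poly p t = 0" if "t \<in> {0<..<1 / (norm x + 1)}" for t
  proof -
    have "norm x + 1 > 0" by (simp add: add_nonneg_pos)
    then have "t * (norm x + 1) < 1" using that by (simp add: pos_less_divide_eq)
    then have "t * norm x < 1" using that by (simp add: distrib_left)
    then show ?thesis
      using that p[of t] by (simp add: assms(2))
  qed
  then have "{0<..<1 / (norm x + 1)} \<subseteq> {t. poly p t = 0}" by auto
  moreover have "infinite {0<..<1 / (norm x + 1)}"
    by (intro infinite_Ioo) (simp add: add_nonneg_pos)
  ultimately have "p = 0"
    using poly_roots_finite finite_subset by blast
  then show ?thesis using p[of 1] by simp
qed

text \<open>The set in the open ball where \<open>f\<close> is nonzero is open and negligible, hence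
  empty. Vanishing is then extended beyond the ball, since equality in the spaces considered is
  equality on all of \<open>real ^ 'd\<close>.\<close>

lemma ball_int_square_eq_0:
  fixes f :: "real ^ 'd::finite \<Rightarrow> real"
  assumes f: "f \<in> polys_of A" and 0: "ball_int (\<lambda>x. f x * f x) = 0"
  shows "f x = 0"
proof (rule polys_eq_0_on_ball[OF f])
  have "set_integrable lborel (cball 0 1) (\<lambda>x. f x * f x)"
    by (intro polys_integrable_ball[where A = UNIV] polys_of_UNIV_mult polys_of_UNIV[OF f]) auto
  then have "AE x in lborel. indicator (cball 0 1) x *\<^sub>R (f x * f x) = 0"
    using 0 unfolding set_integrable_def set_lebesgue_integral_def
    by (subst integral_nonneg_eq_0_iff_AE[symmetric]) (auto simp: indicator_def)
  then have AE: "AE x in lborel. x \<notin> {x \<in> ball 0 1. f x \<noteq> 0}"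
    by eventually_elim auto
  have "open {x \<in> ball 0 1. f x \<noteq> 0}"
    using continuous_on_polys[OF f, of UNIV]
    by (intro open_Collect_conj open_Collect_neq) (auto intro!: continuous_intros open_Collect_less simp: open_ball)
  moreover have "{x \<in> ball 0 1. f x \<noteq> 0} \<in> null_sets lborel"
    using AE calculation by (subst (asm) AE_iff_null_sets[symmetric]) auto
  then have "negligible {x \<in> ball 0 1. f x \<noteq> 0}"
    using null_sets_completionI negligible_iff_null_sets by blast
  ultimately have "{x \<in> ball 0 1. f x \<noteq> 0} = {}"
    using open_not_negligible by blast
  then show "f x = 0" if "norm x < 1" for x
    using that by auto
qed

lemma unit_ball_measure_pos: "measure lborel (cball (0 :: real ^ 'd::finite) 1) > 0"
  by (simp add: content_cball_pos)

text \<open>The constant function 1 in \<open>homogeneous_ball_int\<close> relates the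
  Gamma-function normalization to the volume of the ball. It brings both parts of the inner product
  over one denominator and is the source of the d in \<lambda> = d/(2M).\<close>

lemma sphere_area_eq:
  "sphere_area CARD('d) = real CARD('d) * measure lborel (cball (0 :: real ^ 'd::finite) 1)"
proof -
  let ?S = "sphere (0 :: real ^ 'd) 1"
  have s: "?S \<in> sets surface_measure" by (simp add: surface_measure_def)
  have e: "emeasure surface_measure ?S = ennreal (sphere_area CARD('d))"
    using emeasure_surface_measure_sphere[where 'a = "real ^ 'd"] by simp
  have "sphere_area CARD('d) \<ge> 0"
    unfolding sphere_area_def by (intro divide_nonneg_nonneg mult_nonneg_nonneg less_imp_le[OF Gamma_real_pos]) auto
  then have "measure surface_measure ?S = sphere_area CARD('d)"
    by (simp add: measure_def e)
  moreover have "sphere_int (\<lambda>x :: real ^ 'd. 1) = measure surface_measure ?S"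
    using s e by (subst set_integral_const) auto
  moreover have "ball_int (\<lambda>x :: real ^ 'd. 1) = measure lborel (cball (0 :: real ^ 'd) 1)"
    using emeasure_bounded_finite[of "cball (0 :: real ^ 'd) 1"] by (subst set_integral_const) auto
  moreover have "(real CARD('d) + real 0) * ball_int (\<lambda>x :: real ^ 'd. 1) = sphere_int (\<lambda>x :: real ^ 'd. 1)"
    by (intro homogeneous_ball_int polys_of_const) simp
  ultimately show ?thesis by simp
qed

lemma sphere_area_pos: "sphere_area CARD('d::finite) > 0"
  unfolding sphere_area_eq[where 'd = 'd] using unit_ball_measure_pos[where 'd = 'd] by simp

section \<open>Linear algebra with respect to the inner product\<close>

context
  fixes lam :: real
  assumes lam: "lam \<ge> 0"
begin

lemma ball_sphere_inner_commute: "ball_sphere_inner lam f g = ball_sphere_inner lam g f"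
  by (simp add: ball_sphere_inner_def mult.commute)

lemma ball_sphere_inner_cmult_right: "ball_sphere_inner lam f (\<lambda>x. c * g x) = c * ball_sphere_inner lam f g"
  unfolding ball_sphere_inner_def mult.left_commute[of _ c] set_integral_mult_right
  by (simp add: algebra_simps)

lemma ball_sphere_inner_add_right:
  assumes "f \<in> polys_of UNIV" "g \<in> polys_of UNIV" "h \<in> polys_of UNIV"
  shows "ball_sphere_inner lam f (\<lambda>x. g x + h x) = ball_sphere_inner lam f g + ball_sphere_inner lam f h"
  unfolding ball_sphere_inner_def ring_distribs
    ball_int_add[OF polys_of_UNIV_mult[OF assms(1,2)] polys_of_UNIV_mult[OF assms(1,3)]]
    sphere_int_add[OF polys_of_UNIV_mult[OF assms(1,2)] polys_of_UNIV_mult[OF assms(1,3)]]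
  by (simp add: algebra_simps)

lemma ball_sphere_inner_zero_right: "ball_sphere_inner lam f (\<lambda>x. 0) = 0"
  by (simp add: ball_sphere_inner_def)

lemma ball_sphere_inner_self_eq_0:
  fixes f :: "real ^ 'd::finite \<Rightarrow> real"
  assumes "f \<in> polys_of A" "ball_sphere_inner lam f f = 0"
  shows "f x = 0"
proof (rule ball_int_square_eq_0[OF assms(1)])
  have "ball_int (\<lambda>x. f x * f x) \<ge> 0" "sphere_int (\<lambda>x. f x * f x) \<ge> 0"
    unfolding set_lebesgue_integral_def by (auto intro!: Bochner_Integration.integral_nonneg)
  then have "1 / measure lborel (cball (0 :: real ^ 'd) 1) * ball_int (\<lambda>x. f x * f x) \<ge> 0"
       "lam / sphere_area CARD('d) * sphere_int (\<lambda>x. f x * f x) \<ge> 0"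
    using lam sphere_area_pos[where 'd = 'd] by auto
  then have "1 / measure lborel (cball (0 :: real ^ 'd) 1) * ball_int (\<lambda>x. f x * f x) = 0"
    using assms(2) unfolding ball_sphere_inner_def by linarith
  then show "ball_int (\<lambda>x. f x * f x) = 0"
    using unit_ball_measure_pos[where 'd = 'd] by simp
qed

lemma ball_sphere_inner_span:
  assumes "f \<in> polys_of UNIV" "S \<subseteq> polys_of UNIV" "\<And>g. g \<in> S \<Longrightarrow> ball_sphere_inner lam f g = 0" "h \<in> span S"
  shows "ball_sphere_inner lam f h = 0"
proof -
  have "h \<in> polys_of UNIV \<and> ball_sphere_inner lam f h = 0"
    using assms(4)
  proof (induction rule: span_induct_alt)
    case base
    then show ?case
      using ball_sphere_inner_zero_right[of f] subspace_0[OF subspace_polys_of] by (simp add: zero_fun_def)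
  next
    case (step c g h)
    have eq: "c *\<^sub>R g + h = (\<lambda>x. c * g x + h x)" by (simp add: scaleR_fun_def plus_fun_def)
    have g: "(\<lambda>x. c * g x) \<in> polys_of UNIV"
      using step assms(2) by (intro polys_of_cmult) auto
    show ?case
      unfolding eq using step assms(3) g
      by (simp add: ball_sphere_inner_add_right[OF assms(1) g] ball_sphere_inner_cmult_right polys_of_add)
  qed
  then show ?thesis ..
qed

text \<open>An element in the span of the others would be orthogonal to itself.\<close>

lemma ball_sphere_orthogonal_independent:
  assumes "S \<subseteq> polys_of UNIV" "\<And>f. f \<in> S \<Longrightarrow> ball_sphere_inner lam f f \<noteq> 0"
    and "\<And>f g. f \<in> S \<Longrightarrow> g \<in> S \<Longrightarrow> f \<noteq> g \<Longrightarrow> ball_sphere_inner lam f g = 0"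
  shows "independent S"
proof
  assume "dependent S"
  then obtain f where f: "f \<in> S" "f \<in> span (S - {f})"
    unfolding dependent_def by blast
  have "ball_sphere_inner lam f f = 0"
    by (rule ball_sphere_inner_span[OF _ _ _ f(2)]) (use f(1) assms in auto)
  then show False using assms(2)[OF f(1)] by simp
qed

text \<open>\<open>{..<n}\<close> expresses degree at most n - 1 without subtraction; for
  \<open>n = 0\<close> it gives the zero space, on which the condition is empty.\<close>

lemma orth_polys_eq:
  "orth_polys n lam = {P :: real ^ 'd::finite \<Rightarrow> real. P \<in> polys_of {..n} \<and> (\<forall>R\<in>polys_of {..<n}. ball_sphere_inner lam P R = 0)}"
proof -
  have "(\<forall>m<n. \<forall>R\<in>polys_of {..m}. ball_sphere_inner lam P R = 0) \<longleftrightarrow> (\<forall>R\<in>polys_of {..<n}. ball_sphere_inner lam P R = 0)"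
    for P :: "real ^ 'd \<Rightarrow> real"
  proof (cases n)
    case 0
    have "R \<in> polys_of {} \<Longrightarrow> R = (\<lambda>x. 0)" for R :: "real ^ 'd \<Rightarrow> real"
      by (simp add: polys_of_def zero_fun_def)
    then show ?thesis using 0 ball_sphere_inner_zero_right by auto
  next
    case (Suc m)
    have "polys_of {..l} \<subseteq> (polys_of {..<n} :: (real ^ 'd \<Rightarrow> real) set)" if "l < n" for l
      using that by (intro polys_of_mono) auto
    then show ?thesis using Suc by (auto simp: lessThan_Suc_atMost)
  qed
  then show ?thesis by (simp add: orth_polys_def polys_le_eq)
qed

lemma subspace_orth_polys: "subspace (orth_polys n lam :: (real ^ 'd::finite \<Rightarrow> real) set)"
proof (rule subspaceI)
  show "0 \<in> orth_polys n lam"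
    by (simp add: orth_polys_eq zero_fun_def ball_sphere_inner_zero_right ball_sphere_inner_commute[of "\<lambda>x. 0"])
next
  fix f g :: "real ^ 'd \<Rightarrow> real"
  assume fg: "f \<in> orth_polys n lam" "g \<in> orth_polys n lam"
  have "ball_sphere_inner lam (\<lambda>x. f x + g x) R = 0" if "R \<in> polys_of {..<n}" for R
    using fg that unfolding orth_polys_eq
    by (subst ball_sphere_inner_commute, subst ball_sphere_inner_add_right)
       (auto intro: polys_of_UNIV simp: ball_sphere_inner_commute[of R])
  then show "f + g \<in> orth_polys n lam"
    using fg unfolding orth_polys_eq plus_fun_def by (auto intro: polys_of_add)
next
  fix c and f :: "real ^ 'd \<Rightarrow> real"
  assume f: "f \<in> orth_polys n lam"
  have "ball_sphere_inner lam (\<lambda>x. c * f x) R = 0" if "R \<in> polys_of {..<n}" for R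
    using f that unfolding orth_polys_eq
    by (subst ball_sphere_inner_commute) (simp add: ball_sphere_inner_cmult_right ball_sphere_inner_commute[of R])
  then show "c *\<^sub>R f \<in> orth_polys n lam"
    using f unfolding orth_polys_eq scaleR_fun_def by (auto intro: polys_of_cmult)
qed

end

section \<open>Lifts of univariate polynomials to the ball\<close>

text \<open>The common shape of \<open>ball_P\<close> and \<open>ball_Q\<close>. In t = 2|x|^2 - 1
  one has 1 + t = 2|x|^2 and 1 - t = 2(1 - |x|^2), and t = 1 on the sphere.\<close>

definition ball_lift :: "real poly \<Rightarrow> (real ^ 'd::finite \<Rightarrow> real) \<Rightarrow> real ^ 'd \<Rightarrow> real" where
  "ball_lift p Y x = poly p (2 * (norm x)\<^sup>2 - 1) * Y x"

lemma ball_lift_radial: "ball_lift p Y = (\<lambda>x. poly (pcompose p [:-1, 2:]) ((norm x)\<^sup>2) * Y x)"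
  by (intro ext) (simp add: ball_lift_def poly_pcompose mult.commute)

lemma ball_lift_polys: "Y \<in> polys_of A \<Longrightarrow> ball_lift p Y \<in> polys_of UNIV"
  unfolding ball_lift_radial by (intro polys_of_UNIV_mult polys_of_radial polys_of_UNIV)

lemma pderiv_pcompose_affine: "pderiv (pcompose p [:-1, 2:]) = smult 2 (pcompose (pderiv p) [:-1, 2:])" for p :: "real poly"
  by (simp add: pderiv_pcompose pderiv_pCons)

text \<open>With s = |x|^2 each derivative in s is twice the one in t, and the first-order
  coefficient m + d/2 is \<beta> + 1. The factor 1/4 in the operators makes the second-order
  coefficient exactly 1 - t^2.\<close>

lemma laplacian_ball_lift:
  fixes Y :: "real ^ 'd::finite \<Rightarrow> real"
  assumes Y: "Y \<in> harmonic_polys m"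
  defines "\<beta> \<equiv> real m + (real CARD('d) - 2) / 2"
  shows "1/4 * (1 - (norm x)\<^sup>2) * laplacian (ball_lift p Y) x =
    ball_lift ([:1, 0, -1:] * pderiv (pderiv p) + smult (\<beta> + 1) ([:1, -1:] * pderiv p)) Y x"
  unfolding ball_lift_radial laplacian_radial_mult[OF harmonic_polysD(1)[OF Y]] harmonic_polysD(2)[OF Y]
    pderiv_pcompose_affine pderiv_smult
  by (simp add: poly_pcompose \<beta>_def field_simps power2_eq_square)

lemma euler_ball_lift:
  fixes Y :: "real ^ 'd::finite \<Rightarrow> real"
  assumes Y: "Y \<in> harmonic_polys m"
  shows "euler_op (ball_lift p Y) x = ball_lift (smult 2 ([:1, 1:] * pderiv p) + smult (real m) p) Y x"
  unfolding ball_lift_radial euler_radial_mult[OF harmonic_polysD(1)[OF Y]] pderiv_pcompose_affine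
  by (simp add: poly_pcompose algebra_simps)

lemma op_PQ_ball_lift:
  fixes Y :: "real ^ 'd::finite \<Rightarrow> real"
  assumes Y: "Y \<in> harmonic_polys m" and "real m + (real CARD('d) - 2) / 2 = \<beta>" "\<beta> \<ge> 0"
  shows "op_PQ M (ball_lift (jacobi 0 \<beta> k) Y) x = ball_lift (jacobi_type \<beta> M k) Y x"
  unfolding op_PQ_def laplacian_ball_lift[OF Y] assms(2)
  unfolding ball_lift_def jacobi_type_ladder_up[OF assms(3), symmetric]
  by (simp add: algebra_simps power2_eq_square)

lemma op_QP_ball_lift:
  fixes Y :: "real ^ 'd::finite \<Rightarrow> real"
  assumes Y: "Y \<in> harmonic_polys m" and \<beta>: "real m + (real CARD('d) - 2) / 2 = \<beta>" "\<beta> \<ge> 0"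
  shows "op_QP M (ball_lift (jacobi_type \<beta> M k) Y) x =
     (M + real k * (real k + \<beta>)) * (M + (real k + 1) * (real k + \<beta> + 1)) * ball_lift (jacobi 0 \<beta> k) Y x"
proof -
  \<comment> \<open>The d/2 of the operator and the degree m contributed by \<open>euler_op\<close>
    add up to the \<beta> + 1 of \<open>jacobi_type_ladder_down\<close>.\<close>
  have d: "real CARD('d) / 2 = \<beta> + 1 - real m" using \<beta>(1) by (simp add: field_simps)
  show ?thesis
    unfolding op_QP_def laplacian_ball_lift[OF Y] euler_ball_lift[OF Y] \<beta>(1) d
    unfolding ball_lift_def mult.assoc[symmetric, of "(M + real k * (real k + \<beta>)) * (M + (real k + 1) * (real k + \<beta> + 1))"]
      jacobi_type_ladder_down[OF \<beta>(2), symmetric]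
    by (simp add: algebra_simps power2_eq_square)
qed

text \<open>Polar coordinates, verified on a basis: for (1 + t)^i both sides are known, and the
  denominators match because 2(\<beta> + 1 + i) = d + h + 2i.\<close>

lemma ball_int_lift:
  fixes H :: "real ^ 'd::finite \<Rightarrow> real"
  assumes H: "H \<in> polys_of {h}" and \<beta>: "\<beta> = real h / 2 + (real CARD('d) - 2) / 2" "\<beta> \<ge> 0"
  shows "ball_int (ball_lift f H) = jac_int \<beta> f / (2 * 2 powr (\<beta> + 1)) * sphere_int H"
proof -
  obtain c where c: "f = (\<Sum>i\<le>degree f. smult (c i) ([:1, 1:] ^ i))"
    by (rule poly_expand_at)
  have summand: "ball_int (\<lambda>x. c i * 2 ^ i * (((norm x)\<^sup>2) ^ i * H x))
      = c i * jac_int \<beta> ([:1, 1:] ^ i) / (2 * 2 powr (\<beta> + 1)) * sphere_int H" for i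
  proof -
    have pos: "\<beta> + 1 + real i > 0" using \<beta>(2) by simp
    have "2 * (\<beta> + 1 + real i) = real CARD('d) + real h + 2 * real i"
      by (simp add: \<beta>(1) field_simps)
    then have "2 * (\<beta> + 1 + real i) * ball_int (\<lambda>x. ((norm x)\<^sup>2) ^ i * H x) = sphere_int H"
      by (simp only: ball_int_norm_power_mult[OF H])
    then have 1: "ball_int (\<lambda>x. ((norm x)\<^sup>2) ^ i * H x) = sphere_int H / (2 * (\<beta> + 1 + real i))"
      using pos by (simp add: field_simps)
    have 2: "jac_int \<beta> ([:1, 1:] ^ i) = 2 powr (\<beta> + 1) * 2 ^ i / (\<beta> + 1 + real i)"
      using jac_int_power[OF \<beta>(2), of i] pos by (simp add: field_simps)
    show ?thesis
      unfolding set_integral_mult_right 1 2 by simp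
  qed
  have "ball_lift f H x = (\<Sum>i\<le>degree f. c i * 2 ^ i * (((norm x)\<^sup>2) ^ i * H x))" for x
    by (subst c) (simp add: ball_lift_def poly_sum poly_power power_mult_distrib sum_distrib_right mult.assoc)
  then have "ball_int (ball_lift f H) = ball_int (\<lambda>x. \<Sum>i\<le>degree f. c i * 2 ^ i * (((norm x)\<^sup>2) ^ i * H x))"
    by presburger
  also have "\<dots> = (\<Sum>i\<le>degree f. ball_int (\<lambda>x. c i * 2 ^ i * (((norm x)\<^sup>2) ^ i * H x)))"
    using polys_of_UNIV[OF H]
    by (intro ball_int_sum[where A = UNIV] polys_of_cmult polys_of_UNIV_mult polys_of_norm_sq_power) auto
  also have "\<dots> = (\<Sum>i\<le>degree f. c i * jac_int \<beta> ([:1, 1:] ^ i)) / (2 * 2 powr (\<beta> + 1)) * sphere_int H"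
    unfolding summand by (simp add: sum_distrib_right sum_divide_distrib)
  also have "(\<Sum>i\<le>degree f. c i * jac_int \<beta> ([:1, 1:] ^ i)) = jac_int \<beta> f"
    by (subst (2) c) (simp add: jac_int_sum[OF \<beta>(2)] jac_int_smult)
  finally show ?thesis .
qed

text \<open>A product of lifts is a lift of products, so ball and sphere parts are multiples of one
  sphere integral. The parameter \<beta> uses the mean of the two degrees, hence is the usual one
  when they agree.\<close>

lemma ball_sphere_inner_lift:
  fixes Y Z :: "real ^ 'd::finite \<Rightarrow> real"
  assumes Y: "Y \<in> polys_of {m}" and Z: "Z \<in> polys_of {l}"
    and \<beta>: "\<beta> = (real m + real l) / 2 + (real CARD('d) - 2) / 2" "\<beta> \<ge> 0"
  shows "ball_sphere_inner lam (ball_lift p Y) (ball_lift q Z) =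
    (real CARD('d) * jac_int \<beta> (p * q) / (2 * 2 powr (\<beta> + 1)) + lam * poly (p * q) 1) / sphere_area CARD('d)
      * sphere_int (\<lambda>x. Y x * Z x)"
proof -
  have H: "(\<lambda>x. Y x * Z x) \<in> polys_of {m + l}"
    by (intro polys_of_mult[OF Y Z]) auto
  have eq: "(\<lambda>x. ball_lift p Y x * ball_lift q Z x) = ball_lift (p * q) (\<lambda>x. Y x * Z x)"
    by (intro ext) (simp add: ball_lift_def)
  have "sphere_int (ball_lift (p * q) (\<lambda>x. Y x * Z x)) = sphere_int (\<lambda>x. poly (p * q) 1 * (Y x * Z x))"
    by (rule sphere_int_cong) (simp add: ball_lift_def)
  then have s: "sphere_int (ball_lift (p * q) (\<lambda>x. Y x * Z x)) = poly (p * q) 1 * sphere_int (\<lambda>x. Y x * Z x)"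
    by (simp only: set_integral_mult_right)
  have b: "ball_int (ball_lift (p * q) (\<lambda>x. Y x * Z x)) = jac_int \<beta> (p * q) / (2 * 2 powr (\<beta> + 1)) * sphere_int (\<lambda>x. Y x * Z x)"
    using \<beta> by (intro ball_int_lift[OF H]) auto
  have "measure lborel (cball (0 :: real ^ 'd) 1) = sphere_area CARD('d) / real CARD('d)"
    using sphere_area_eq[where 'd = 'd] by simp
  then show ?thesis
    unfolding ball_sphere_inner_def eq s b using sphere_area_pos[where 'd = 'd] by (simp add: field_simps)
qed

lemma ball_lift_jacobi_type_orthogonal:
  fixes Y Z :: "real ^ 'd::finite \<Rightarrow> real"
  assumes d: "CARD('d) \<ge> 2" and M: "M > 0"
    and Y: "Y \<in> harmonic_polys m" and Z: "Z \<in> harmonic_polys l"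
    and \<beta>: "real m + (real CARD('d) - 2) / 2 = \<beta>" "\<beta> \<ge> 0" and deg: "l + 2 * j < m + 2 * k"
  shows "ball_sphere_inner (real CARD('d) / (2 * M)) (ball_lift (jacobi_type \<beta> M k) Y) (\<lambda>x. ((norm x)\<^sup>2) ^ j * Z x) = 0"
proof -
  \<comment> \<open>The factor \<open>(1/2) ^ j\<close> compensates for 1 + t = 2|x|^2.\<close>
  have eq: "(\<lambda>x. ((norm x)\<^sup>2) ^ j * Z x) = ball_lift (smult ((1/2) ^ j) ([:1, 1:] ^ j)) Z"
    by (intro ext) (simp add: ball_lift_def poly_power power_mult_distrib power_divide)
  note formula = ball_sphere_inner_lift[OF harmonic_polysD(1)[OF Y] harmonic_polysD(1)[OF Z] refl]
  show ?thesis
  proof (cases "m = l")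
    case False
    then show ?thesis
      unfolding eq using sphere_int_harmonic_orthogonal[OF Y Z False d] d by (subst formula) auto
  next
    case True
    then have "j < k" using deg by simp
    let ?q = "jacobi_type \<beta> M k * smult ((1/2) ^ j) ([:1, 1:] ^ j)"
    \<comment> \<open>In the radial bracket the ball contributes -d/2 and the sphere contributes
      \<lambda>M = d/2; this cancellation determines \<lambda>.\<close>
    have "jac_int \<beta> ?q = - (2 powr (\<beta> + 1))"
      using jac_int_jacobi_type[OF \<beta>(2) \<open>j < k\<close>, of M]
      by (simp add: jac_int_smult power_divide)
    moreover have "poly ?q 1 = M"
      using poly_jacobi_type_1[OF \<beta>(2)] by (simp add: poly_power power_divide)
    moreover have "(real m + real l) / 2 + (real CARD('d) - 2) / 2 = \<beta>" using \<beta>(1) True by simp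
    ultimately show ?thesis
      unfolding eq using M \<beta>(2) by (subst formula) simp_all
  qed
qed

lemma ball_lift_in_orth_polys:
  fixes Y :: "real ^ 'd::finite \<Rightarrow> real"
  assumes d: "CARD('d) \<ge> 2" and M: "M > 0"
    and Y: "Y \<in> harmonic_polys m"
    and \<beta>: "real m + (real CARD('d) - 2) / 2 = \<beta>" "\<beta> \<ge> 0" and n: "n = m + 2 * k"
  shows "ball_lift (jacobi_type \<beta> M k) Y \<in> orth_polys n (real CARD('d) / (2 * M))"
proof -
  let ?lam = "real CARD('d) / (2 * M)" and ?Q = "ball_lift (jacobi_type \<beta> M k) Y"
  have lam: "?lam \<ge> 0" using M by simp
  have Q: "?Q \<in> polys_of UNIV" by (rule ball_lift_polys[OF harmonic_polysD(1)[OF Y]])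
  have "degree (pcompose (jacobi_type \<beta> M k) [:-1, 2:]) \<le> k"
    using degree_jacobi_type_le[OF \<beta>(2)] by (simp add: degree_pcompose)
  then have "?Q \<in> polys_of {..n}"
    unfolding ball_lift_radial n
    by (intro polys_of_mult[OF _ harmonic_polysD(1)[OF Y], of _ "{..2 * k}"])
       (auto simp: poly_altdef intro!: polys_of_sum polys_of_cmult polys_of_norm_sq_power)
  moreover have "ball_sphere_inner ?lam ?Q R = 0" if "R \<in> polys_of {..<n}" for R
  proof -
    have S: "solid_harmonic_products l \<subseteq> (polys_of UNIV :: (real ^ 'd \<Rightarrow> real) set)" for l
      unfolding solid_harmonic_products_def
      by (auto intro!: polys_of_UNIV_mult polys_of_norm_sq_power dest: harmonic_polysD(1) polys_of_UNIV)
    \<comment> \<open>Testing on monomials suffices, and each monomial is homogeneous, so it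
      decomposes into products of lower total degree than \<open>n\<close>.\<close>
    have mono: "ball_sphere_inner ?lam ?Q (monomial_fun a) = 0" if "(\<Sum>i\<in>UNIV. a i) < n" for a
    proof (rule ball_sphere_inner_span[OF lam Q S])
      show "monomial_fun a \<in> span (solid_harmonic_products (\<Sum>i\<in>UNIV. a i))"
        using homogeneous_polys_decomposition polys_of_monomial by blast
      show "ball_sphere_inner ?lam ?Q g = 0" if "g \<in> solid_harmonic_products (\<Sum>i\<in>UNIV. a i)" for g
        using that \<open>(\<Sum>i\<in>UNIV. a i) < n\<close> n unfolding solid_harmonic_products_def
        by (auto intro!: ball_lift_jacobi_type_orthogonal[OF d M Y _ \<beta>])
    qed
    show ?thesis
      by (rule ball_sphere_inner_span[OF lam Q _ _ that[unfolded polys_of_def]])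
         (use mono in \<open>auto intro: polys_of_monomial\<close>)
  qed
  ultimately show ?thesis by (simp add: orth_polys_eq[OF lam])
qed

text \<open>The lift is \<open>Y\<close> times a polynomial in |x|^2 of exact degree k, so its top
  term can be solved for; the other terms have degree at most m + 2k - 2.\<close>

lemma norm_power_mult_in_span_ball_lift:
  fixes Y :: "real ^ 'd::finite \<Rightarrow> real"
  assumes M: "M > 0" and Y: "Y \<in> harmonic_polys m" and \<beta>: "\<beta> \<ge> 0"
  shows "(\<lambda>x. ((norm x)\<^sup>2) ^ k * Y x) \<in> span ({ball_lift (jacobi_type \<beta> M k) Y} \<union> polys_of {..<m + 2 * k})"
proof -
  define q where "q = jacobi_type \<beta> M k"
  define g where "g = pcompose q [:-1, 2:]"
  define F where "F i = (\<lambda>x. ((norm x)\<^sup>2) ^ i * Y x)" for i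
  let ?W = "span ({ball_lift q Y} \<union> polys_of {..<m + 2 * k})"
  have q: "coeff q k \<noteq> 0" "degree q \<le> k"
    unfolding q_def using lead_coeff_jacobi_type[OF \<beta> M] degree_jacobi_type_le[OF \<beta>] by auto
  then have dq: "degree q = k" using le_degree by fastforce
  have dg: "degree g = k" by (simp add: g_def degree_pcompose dq)
  have "lead_coeff g = lead_coeff q * 2 ^ k"
    unfolding g_def by (subst lead_coeff_comp) (simp_all add: dq)
  then have cg: "coeff g k \<noteq> 0" using q(1) by (simp add: dg dq)
  have "F i \<in> polys_of {m + 2 * i}" for i
    unfolding F_def by (intro polys_of_mult[OF polys_of_norm_sq_power[of _ "{2 * i}"] harmonic_polysD(1)[OF Y]]) auto
  then have low: "F i \<in> polys_of {..<m + 2 * k}" if "i < k" for i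
    using polys_of_mono[of "{m + 2 * i}" "{..<m + 2 * k}"] that by auto
  define L where "L = (\<lambda>x. \<Sum>i<k. coeff g i * F i x)"
  have L: "L \<in> polys_of {..<m + 2 * k}"
    unfolding L_def by (intro polys_of_sum polys_of_cmult low) auto
  have "ball_lift q Y x = coeff g k * F k x + L x" for x
    unfolding ball_lift_radial g_def[symmetric] F_def L_def
    by (simp add: poly_altdef dg distrib_right sum_distrib_right mult.assoc flip: lessThan_Suc_atMost)
  then have "F k = (1 / coeff g k) *\<^sub>R (ball_lift q Y - L)"
    using cg by (auto simp: scaleR_fun_def fun_eq_iff)
  moreover have "(1 / coeff g k) *\<^sub>R (ball_lift q Y - L) \<in> ?W"
    using L by (intro span_scale span_diff span_base) auto
  ultimately show ?thesis by (simp add: F_def q_def)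
qed

theorem theorem5p1:
  fixes M :: real and n :: nat
    and Y :: "nat \<Rightarrow> nat \<Rightarrow> real ^ 'd::finite \<Rightarrow> real"
  assumes "CARD('d) \<ge> 2" and "M > 0"
    and basis: "\<And>k. 2 * k \<le> n \<Longrightarrow>
      indexed_basis {1..dim (harmonic_polys (n - 2 * k) :: (real ^ 'd \<Rightarrow> real) set)}
        (Y (n - 2 * k)) (harmonic_polys (n - 2 * k))"
    and orthonormal: "\<And>k \<nu> \<mu>. 2 * k \<le> n \<Longrightarrow>
      \<nu> \<in> {1..dim (harmonic_polys (n - 2 * k) :: (real ^ 'd \<Rightarrow> real) set)} \<Longrightarrow>
      \<mu> \<in> {1..dim (harmonic_polys (n - 2 * k) :: (real ^ 'd \<Rightarrow> real) set)} \<Longrightarrow>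
      sphere_inner (Y (n - 2 * k) \<nu>) (Y (n - 2 * k) \<mu>) = (if \<nu> = \<mu> then 1 else 0)"
  shows "let d = CARD('d);
             lam = real d / (2 * M);
             I = {(k, \<nu>). 2 * k \<le> n \<and>
                   \<nu> \<in> {1..dim (harmonic_polys (n - 2 * k) :: (real ^ 'd \<Rightarrow> real) set)}};
             P = ball_P Y n;
             Q = ball_Q M Y n
         in indexed_basis I (\<lambda>(k, \<nu>). Q k \<nu>) (orth_polys n lam)
          \<and> (\<forall>(k, \<nu>)\<in>I. \<forall>(k', \<nu>')\<in>I. (k, \<nu>) \<noteq> (k', \<nu>') \<longrightarrow>
                ball_sphere_inner lam (Q k \<nu>) (Q k' \<nu>') = 0)
          \<and> (\<forall>(k, \<nu>)\<in>I. \<forall>x.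
                op_PQ M (P k \<nu>) x = Q k \<nu> x
              \<and> op_QP M (Q k \<nu>) x = eigenval d M n k * P k \<nu> x
              \<and> op_PQ M (op_QP M (Q k \<nu>)) x = eigenval d M n k * Q k \<nu> x)"
proof -
  let ?d = "CARD('d)"
  define lam where "lam = real ?d / (2 * M)"
  define a where "a m = dim (harmonic_polys m :: (real ^ 'd \<Rightarrow> real) set)" for m
  define I where "I = {(k, \<nu>). 2 * k \<le> n \<and> \<nu> \<in> {1..a (n - 2 * k)}}"
  define \<beta> where "\<beta> k = beta_par ?d n k" for k
  define P where "P = ball_P Y n"
  define Q where "Q = ball_Q M Y n"
  have P_eq: "P k \<nu> = ball_lift (jacobi 0 (\<beta> k) k) (Y (n - 2 * k) \<nu>)" for k \<nu>
    by (intro ext) (simp add: P_def ball_P_def ball_lift_def \<beta>_def)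
  have Q_eq: "Q k \<nu> = ball_lift (jacobi_type (\<beta> k) M k) (Y (n - 2 * k) \<nu>)" for k \<nu>
    by (intro ext) (simp add: Q_def ball_Q_def ball_lift_def \<beta>_def)
  have lam: "lam \<ge> 0" using \<open>M > 0\<close> by (simp add: lam_def)
  have \<beta>: "real (n - 2 * k) + (real ?d - 2) / 2 = \<beta> k" "\<beta> k \<ge> 0" if "2 * k \<le> n" for k
    using that \<open>?d \<ge> 2\<close> by (simp_all add: \<beta>_def beta_par_def of_nat_diff)
  have span_Y: "span (Y (n - 2 * k) ` {1..a (n - 2 * k)}) = harmonic_polys (n - 2 * k)" if "2 * k \<le> n" for k
    using basis[OF that] by (simp add: indexed_basis_def a_def)
  have Y: "Y (n - 2 * k) \<nu> \<in> harmonic_polys (n - 2 * k)" if "(k, \<nu>) \<in> I" for k \<nu>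
    using that span_Y[of k] span_base[of "Y (n - 2 * k) \<nu>" "Y (n - 2 * k) ` {1..a (n - 2 * k)}"]
    by (auto simp: I_def)
  have Q_polys: "Q k \<nu> \<in> polys_of UNIV" if "(k, \<nu>) \<in> I" for k \<nu>
    unfolding Q_eq by (rule ball_lift_polys[OF harmonic_polysD(1)[OF Y[OF that]]])
  have YY: "sphere_int (\<lambda>x. Y (n - 2 * k) \<nu> x * Y (n - 2 * k) \<mu> x) = (if \<nu> = \<mu> then sphere_area ?d else 0)"
    if "(k, \<nu>) \<in> I" "(k, \<mu>) \<in> I" for k \<nu> \<mu>
    using orthonormal[of k \<nu> \<mu>] that sphere_area_pos[where 'd = 'd]
    by (auto simp: I_def a_def sphere_inner_def field_simps split: if_splits)
  have orth: "ball_sphere_inner lam (Q k \<nu>) (Q k' \<nu>') = 0"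
    if "(k, \<nu>) \<in> I" "(k', \<nu>') \<in> I" "(k, \<nu>) \<noteq> (k', \<nu>')" for k \<nu> k' \<nu>'
  proof -
    have "sphere_int (\<lambda>x. Y (n - 2 * k) \<nu> x * Y (n - 2 * k') \<nu>' x) = 0"
    proof (cases "k = k'")
      case True
      then show ?thesis using YY[of k \<nu> \<nu>'] that by auto
    next
      case False
      then have "n - 2 * k \<noteq> n - 2 * k'" using that by (auto simp: I_def)
      then show ?thesis
        using sphere_int_harmonic_orthogonal[OF Y[OF that(1)] Y[OF that(2)]] \<open>?d \<ge> 2\<close> by blast
    qed
    then show ?thesis
      unfolding Q_eq using \<open>?d \<ge> 2\<close>
      by (subst ball_sphere_inner_lift[OF harmonic_polysD(1)[OF Y[OF that(1)]] harmonic_polysD(1)[OF Y[OF that(2)]] refl]) auto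
  qed
  have nonzero: "ball_sphere_inner lam (Q k \<nu>) (Q k \<nu>) \<noteq> 0" if I: "(k, \<nu>) \<in> I" for k \<nu>
  proof
    assume "ball_sphere_inner lam (Q k \<nu>) (Q k \<nu>) = 0"
    then have Q0: "Q k \<nu> x = 0" for x
      by (rule ball_sphere_inner_self_eq_0[OF lam Q_polys[OF I]])
    have "\<beta> k \<ge> 0" using \<beta> I by (auto simp: I_def)
    \<comment> \<open>On the sphere the radial factor takes the value \<open>M\<close>, which is
      nonzero, so a vanishing \<open>Q k \<nu>\<close> would make the normalized harmonic vanish
      there.\<close>
    then have Y0: "Y (n - 2 * k) \<nu> x = 0" if "norm x = 1" for x
      using Q0[of x] that \<open>M > 0\<close> by (simp add: Q_eq ball_lift_def poly_jacobi_type_1)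
    have "sphere_int (\<lambda>x. Y (n - 2 * k) \<nu> x * Y (n - 2 * k) \<nu> x) = sphere_int (\<lambda>x :: real ^ 'd. 0)"
      by (rule sphere_int_cong) (simp add: Y0)
    then show False using YY[OF I I] sphere_area_pos[where 'd = 'd] by simp
  qed
  let ?Q = "\<lambda>(k, \<nu>). Q k \<nu>"
  have Q_orth_polys: "?Q ` I \<subseteq> orth_polys n lam"
  proof clarify
    fix k \<nu> assume I: "(k, \<nu>) \<in> I"
    then have k: "2 * k \<le> n" by (simp add: I_def)
    show "Q k \<nu> \<in> orth_polys n lam"
      unfolding Q_eq lam_def
      by (rule ball_lift_in_orth_polys[OF \<open>?d \<ge> 2\<close> \<open>M > 0\<close> Y[OF I] \<beta>[OF k]]) (use k in simp)
  qed
  have "inj_on ?Q I"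
  proof (rule inj_onI, clarify)
    fix k \<nu> k' \<nu>' assume *: "(k, \<nu>) \<in> I" "(k', \<nu>') \<in> I" "Q k \<nu> = Q k' \<nu>'"
    \<comment> \<open>Equal functions at distinct indices would be orthogonal to themselves.\<close>
    show "k = k' \<and> \<nu> = \<nu>'"
      using orth[OF *(1,2)] nonzero[OF *(1)] *(3) by auto
  qed
  moreover have "independent (?Q ` I)"
  proof (rule ball_sphere_orthogonal_independent[OF lam])
    show "?Q ` I \<subseteq> polys_of UNIV" using Q_polys by auto
    show "ball_sphere_inner lam f f \<noteq> 0" if "f \<in> ?Q ` I" for f
      using that nonzero by auto
    show "ball_sphere_inner lam f g = 0" if fg: "f \<in> ?Q ` I" "g \<in> ?Q ` I" "f \<noteq> g" for f g
    proof -
      obtain k \<nu> k' \<nu>' where *: "(k, \<nu>) \<in> I" "(k', \<nu>') \<in> I" "f = Q k \<nu>" "g = Q k' \<nu>'"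
        using fg by auto
      then show ?thesis using orth[OF *(1,2)] fg(3) by auto
    qed
  qed
  moreover have "span (?Q ` I) = orth_polys n lam"
  proof
    show "span (?Q ` I) \<subseteq> orth_polys n lam"
      by (rule span_minimal[OF Q_orth_polys subspace_orth_polys[OF lam]])
    let ?W = "span (?Q ` I \<union> polys_of {..<n})"
    have top: "(\<lambda>x. ((norm x)\<^sup>2) ^ k * Z x) \<in> ?W" if k: "2 * k \<le> n" and Z: "Z \<in> harmonic_polys (n - 2 * k)" for k Z
    proof -
      have "Z \<in> span (Y (n - 2 * k) ` {1..a (n - 2 * k)})" using Z span_Y[OF k] by simp
      then show ?thesis
      proof (induction rule: span_induct_alt)
        case base
        have "(\<lambda>x. ((norm x)\<^sup>2) ^ k * (0 :: real ^ 'd \<Rightarrow> real) x) = 0" by (simp add: zero_fun_def)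
        then show ?case by (metis span_zero)
      next
        case (step c y z)
        then obtain \<nu> where \<nu>: "y = Y (n - 2 * k) \<nu>" "(k, \<nu>) \<in> I" using k by (auto simp: I_def)
        have "(\<lambda>x. ((norm x)\<^sup>2) ^ k * y x) \<in> span ({Q k \<nu>} \<union> polys_of {..<n - 2 * k + 2 * k})"
          unfolding Q_eq \<nu>(1) by (rule norm_power_mult_in_span_ball_lift[OF \<open>M > 0\<close> Y[OF \<nu>(2)] \<beta>(2)[OF k]])
        also have "\<dots> \<subseteq> ?W"
          using k \<nu>(2) by (intro span_mono) force
        finally have "c *\<^sub>R (\<lambda>x. ((norm x)\<^sup>2) ^ k * y x) + (\<lambda>x. ((norm x)\<^sup>2) ^ k * z x) \<in> ?W"
          using step.IH by (intro span_add span_scale)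
        moreover have "c *\<^sub>R (\<lambda>x. ((norm x)\<^sup>2) ^ k * y x) + (\<lambda>x. ((norm x)\<^sup>2) ^ k * z x)
            = (\<lambda>x. ((norm x)\<^sup>2) ^ k * (c *\<^sub>R y + z) x)"
          by (simp add: fun_eq_iff scaleR_fun_def algebra_simps)
        ultimately show ?case by simp
      qed
    qed
    have "solid_harmonic_products n \<subseteq> ?W"
      unfolding solid_harmonic_products_def using top by auto
    then have hom: "polys_of {n} \<subseteq> ?W"
      using homogeneous_polys_decomposition[of n] span_minimal[OF _ subspace_span] by blast
    have "polys_of {..n} \<subseteq> ?W"
      unfolding polys_of_def[of "{..n}"]
    proof (rule span_minimal[OF _ subspace_span], rule image_subsetI)
      fix b :: "'d \<Rightarrow> nat" assume "b \<in> {b. sum b UNIV \<in> {..n}}"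
      then consider "sum b UNIV = n" | "sum b UNIV < n" by force
      then show "monomial_fun b \<in> ?W"
      proof cases
        case 1
        then show ?thesis using hom polys_of_monomial[of b "{n}"] by auto
      next
        case 2
        then show ?thesis using polys_of_monomial[of b "{..<n}"] by (auto intro: span_base)
      qed
    qed
    moreover have "?W = {u + v | u v. u \<in> span (?Q ` I) \<and> v \<in> polys_of {..<n}}"
    proof -
      have "span (polys_of {..<n}) = (polys_of {..<n} :: (real ^ 'd \<Rightarrow> real) set)"
        by (simp add: span_eq_iff)
      then show ?thesis by (simp only: span_Un)
    qed
    ultimately have decomp: "\<exists>u v. f = u + v \<and> u \<in> span (?Q ` I) \<and> v \<in> polys_of {..<n}" if "f \<in> polys_of {..n}" for f
      using that by blast
    show "orth_polys n lam \<subseteq> span (?Q ` I)"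
    proof
      fix f :: "real ^ 'd \<Rightarrow> real" assume f: "f \<in> orth_polys n lam"
      then have "f \<in> polys_of {..n}" by (simp add: orth_polys_eq[OF lam])
      then obtain u v where uv: "f = u + v" "u \<in> span (?Q ` I)" "v \<in> polys_of {..<n}"
        using decomp by meson
      have "u \<in> orth_polys n lam"
        using uv(2) \<open>span (?Q ` I) \<subseteq> orth_polys n lam\<close> by blast
      then have "f - u \<in> orth_polys n lam"
        using f subspace_orth_polys[OF lam] by (intro subspace_diff)
      then have "v \<in> orth_polys n lam" by (simp add: uv(1))
      then have "ball_sphere_inner lam v v = 0"
        using uv(3) by (simp add: orth_polys_eq[OF lam])
      then have "v x = 0" for x
        by (rule ball_sphere_inner_self_eq_0[OF lam uv(3)])
      then have "v = 0" by (simp add: fun_eq_iff)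
      then show "f \<in> span (?Q ` I)" using uv by simp
    qed
  qed
  ultimately have "indexed_basis I ?Q (orth_polys n lam)" by (simp add: indexed_basis_def)
  moreover have pde: "op_PQ M (P k \<nu>) x = Q k \<nu> x" "op_QP M (Q k \<nu>) x = eigenval ?d M n k * P k \<nu> x"
    if I: "(k, \<nu>) \<in> I" for k \<nu> x
  proof -
    have k: "2 * k \<le> n" using I by (simp add: I_def)
    show "op_PQ M (P k \<nu>) x = Q k \<nu> x"
      unfolding P_eq Q_eq by (rule op_PQ_ball_lift[OF Y[OF I] \<beta>[OF k]])
    \<comment> \<open>The factors agree because n - k + (d - 2)/2 = k +
      \<open>\<beta> k\<close>.\<close>
    have "eigenval ?d M n k = (M + real k * (real k + \<beta> k)) * (M + (real k + 1) * (real k + \<beta> k + 1))"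
      by (simp add: eigenval_def \<beta>_def beta_par_def field_simps)
    then show "op_QP M (Q k \<nu>) x = eigenval ?d M n k * P k \<nu> x"
      unfolding P_eq Q_eq by (simp only: op_QP_ball_lift[OF Y[OF I] \<beta>[OF k]])
  qed
  moreover have "op_PQ M (op_QP M (Q k \<nu>)) x = eigenval ?d M n k * Q k \<nu> x" if I: "(k, \<nu>) \<in> I" for k \<nu> x
  proof -
    \<comment> \<open>An equality of functions is required, since \<open>op_PQ\<close>
      differentiates its argument; the constant then leaves the Laplacian because
      \<open>P k \<nu>\<close> is polynomial.\<close>
    have "op_QP M (Q k \<nu>) = (\<lambda>x. eigenval ?d M n k * P k \<nu> x)"
      using pde(2)[OF I] by blast
    moreover have P_polys: "P k \<nu> \<in> polys_of UNIV"
      unfolding P_eq by (rule ball_lift_polys[OF harmonic_polysD(1)[OF Y[OF I]]])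
    ultimately have "op_PQ M (op_QP M (Q k \<nu>)) x = eigenval ?d M n k * op_PQ M (P k \<nu>) x"
      by (simp only: op_PQ_def laplacian_cmult[OF P_polys]) (simp add: algebra_simps)
    then show ?thesis using pde(1)[OF I] by simp
  qed
  ultimately show ?thesis
    unfolding Let_def lam_def[symmetric] a_def[symmetric] I_def[symmetric] P_def[symmetric] Q_def[symmetric]
    using orth by auto
qed

end
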